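(* Let $q$ be a prime power, $r\ge1$ an integer, $\alpha_1,\ldots,\alpha_r$ independent Haar-random elements of $\mathfrak p=t^{-1}\mathbb F_q[[t^{-1}]]$, and $n\ge0$. With the notation of the context, define $I_n=0$ on $\{J^{(r)}_n=0\}$. On the event $\{J^{(r)}_n=1\}$ there is a unique random index $I_n\in\{1,\ldots,r\}$ such that $$\Delta^{(r)}_n=\tau_{n,I_n}.$$ For $1\le j\le r$, the following conditional identity holds almost surely: $$\mathbb P(I_n=j\mid\mathcal F_{T_n+1})=\mathbf 1_{\{J^{(r)}_n=1\}}\,q^{j-r}\prod_{a=1}^{j-1}(1-q^{a-r}),$$ where an empty product equals one. Also, $$\mathbb P(I_n=0\mid\mathcal F_{T_n+1})=\mathbf 1_{\{J^{(r)}_n=0\}}.$$ Moreover, $$\Delta^{(r)}_n\le\mathcal S^{(r)}_n+r\qquad\text{on }\{J^{(r)}_n=1\},$$ and for every integer $h\ge r+1$, $$\mathbb P\bigl(\Delta^{(r)}_n\ge h\mid J^{(r)}_n=1\bigr)\le\frac{q^{r+1-h}}{q-1},$$ an estimate which is uniform in $n$.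
   Context: Write $\alpha_i=\sum_{j\ge1}u^{(i)}_jt^{-j}$ with $u^{(i)}_j\in\mathbb F_q$. Under product Haar probability measure on $\mathfrak p^r$ the coefficient vectors $\boldsymbol u_j=(u^{(1)}_j,\ldots,u^{(r)}_j)$, $j\ge1$, are iid uniform on $\mathbb F_q^r$. For $n\ge0$ and $d\ge1$ let $H^{(r)}(n;d)$ be the $rn\times d$ matrix over $\mathbb F_q$ obtained by stacking, for $i=1,\ldots,r$, the $n\times d$ Hankel blocks with $(a,b)$ entry $u^{(i)}_{a+b-1}$ ($1\le a\le n$, $1\le b\le d$); for $n=0$ it is the empty matrix with $d$ columns, whose kernel is $\mathbb F_q^d$. A vector $(\theta_0,\ldots,\theta_{d-1})^{\mathsf T}$ lies in $\ker H^{(r)}(n;d)$ exactly when, for $Q=\sum_k\theta_kt^k$, the coefficients of $t^{-1},\ldots,t^{-n}$ in every $Q\alpha_i$ vanish. Put $$L_r(n)=\min\{d\ge1:\ker H^{(r)}(n;d)\ne0\},\quad D_n=L_r(n),\quad \Delta^{(r)}_n=D_{n+1}-D_n,\quad \mathcal S^{(r)}_n=rn+1-D_n,$$ $$J^{(r)}_n=\mathbf 1_{\{L_r(n+1)>L_r(n)\}},\qquad T_n=n+D_n-1.$$ Kernel-growth epochs: for $k\ge0$ let $\nu_{n,k}=\dim\ker H^{(r)}(n;D_n+k)$. One has $\nu_{n,0}=1$ and $\nu_{n,k}-\nu_{n,k-1}\in\{0,1\}$. For $1\le j\le r$, $$\tau_{n,j}=\inf\{k\ge1:\nu_{n,k}=j+1\},$$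 which is always finite. Filtration: $\mathcal F_N=\sigma(u^{(i)}_j:1\le i\le r,\ 1\le j\le N)$, $N\ge0$. $T_n$ (hence $T_n+1$) is a stopping time for $(\mathcal F_N)_{N\ge0}$, and for a stopping time $T$ the stopped sigma-algebra is $\mathcal F_T=\{A:A\cap\{T\le N\}\in\mathcal F_N\text{ for every }N\ge0\}$. *)

theory Defs
  imports
    "HOL-Probability.Probability"
    "HOL-Computational_Algebra.Formal_Laurent_Series"
    "Jordan_Normal_Form.Matrix_Kernel"
begin

text \<open>
  The field with \<open>q\<close> elements is a type \<open>'a :: {field, finite}\<close>, with \<open>q = CARD('a)\<close>.
  The formal variable of \<^typ>\<open>'a fls\<close> plays the role of \<open>t\<^sup>-\<^sup>1\<close>, so
  \<open>fls_nth f j\<close> is the coefficient of \<open>t\<^sup>-\<^sup>j\<close>. The metric on \<^typ>\<open>'a fls\<close>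
  from the library induces the usual topology.
\<close>

definition pp :: "'a::{field,finite} fls set" where
  "pp = {f. \<forall>k\<le>0. fls_nth f k = 0}"

definition borel_pp :: "'a::{field,finite} fls measure" where
  "borel_pp = restrict_space borel pp"

definition haar_prob :: "'a::{field,finite} fls measure \<Rightarrow> bool" where
  "haar_prob \<mu> \<longleftrightarrow> prob_space \<mu> \<and> sets \<mu> = sets borel_pp \<and>
     (\<forall>a\<in>pp. \<forall>A\<in>sets \<mu>. emeasure \<mu> ((+) a ` A) = emeasure \<mu> A)"

text \<open>
  A tuple \<open>(x\<^sub>1, \<dots>, x\<^sub>r)\<close> is a function \<open>x\<close> on \<^typ>\<open>nat\<close>, of which only the values on
  \<open>{1..r}\<close> are used. Rows and columns of \<^typ>\<open>'a mat\<close> are numbered from 0: row \<open>k\<close> is row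
  \<open>a = k mod n + 1\<close> of block \<open>i = k div n + 1\<close>, and column \<open>l\<close> is \<open>b = l + 1\<close>, whence
  \<open>a + b - 1 = k mod n + l + 1\<close>.
\<close>

definition hankel_stack ::
    "nat \<Rightarrow> (nat \<Rightarrow> 'a::{field,finite} fls) \<Rightarrow> nat \<Rightarrow> nat \<Rightarrow> 'a mat" where
  "hankel_stack r x n d =
     mat (r * n) d (\<lambda>(k, l). fls_nth (x (k div n + 1)) (int (k mod n + l + 1)))"

definition Lmin :: "nat \<Rightarrow> (nat \<Rightarrow> 'a::{field,finite} fls) \<Rightarrow> nat \<Rightarrow> nat" where
  "Lmin r x n = (LEAST d. d \<ge> 1 \<and> mat_kernel (hankel_stack r x n d) \<noteq> {0\<^sub>v d})"

definition Delta :: "nat \<Rightarrow> (nat \<Rightarrow> 'a::{field,finite} fls) \<Rightarrow> nat \<Rightarrow> int" where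
  "Delta r x n = int (Lmin r x (n + 1)) - int (Lmin r x n)"

definition slack :: "nat \<Rightarrow> (nat \<Rightarrow> 'a::{field,finite} fls) \<Rightarrow> nat \<Rightarrow> int" where
  "slack r x n = int (r * n + 1) - int (Lmin r x n)"

definition jump :: "nat \<Rightarrow> (nat \<Rightarrow> 'a::{field,finite} fls) \<Rightarrow> nat \<Rightarrow> nat" where
  "jump r x n = of_bool (Lmin r x (n + 1) > Lmin r x n)"

definition Ttime :: "nat \<Rightarrow> (nat \<Rightarrow> 'a::{field,finite} fls) \<Rightarrow> nat \<Rightarrow> nat" where
  "Ttime r x n = n + Lmin r x n - 1"

definition nu :: "nat \<Rightarrow> (nat \<Rightarrow> 'a::{field,finite} fls) \<Rightarrow> nat \<Rightarrow> nat \<Rightarrow> nat" where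
  "nu r x n k = kernel_dim (hankel_stack r x n (Lmin r x n + k))"

text \<open>
  The set below is never empty, so the value of \<^term>\<open>Inf {} :: nat\<close> plays no role. (It
  is 0, which is not a possible value of a positive increment.)
\<close>

definition tau :: "nat \<Rightarrow> (nat \<Rightarrow> 'a::{field,finite} fls) \<Rightarrow> nat \<Rightarrow> nat \<Rightarrow> nat" where
  "tau r x n j = Inf {k. k \<ge> 1 \<and> nu r x n k = j + 1}"

definition jump_index :: "nat \<Rightarrow> (nat \<Rightarrow> 'a::{field,finite} fls) \<Rightarrow> nat \<Rightarrow> nat" where
  "jump_index r x n =
     (if jump r x n = 0 then 0
      else (THE i. i \<in> {1..r} \<and> Delta r x n = int (tau r x n i)))"

definition coeff_filtration ::
    "'w measure \<Rightarrow> nat \<Rightarrow> (nat \<Rightarrow> 'w \<Rightarrow> 'a::{field,finite} fls) \<Rightarrow> nat \<Rightarrow> 'w measure" where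
  "coeff_filtration M r \<alpha> N =
     sigma (space M)
       {{\<omega> \<in> space M. fls_nth (\<alpha> i \<omega>) (int j) = c} | i j c. i \<in> {1..r} \<and> j \<in> {1..N}}"

definition stopped_sigma ::
    "'w measure \<Rightarrow> nat \<Rightarrow> (nat \<Rightarrow> 'w \<Rightarrow> 'a::{field,finite} fls) \<Rightarrow> ('w \<Rightarrow> nat) \<Rightarrow> 'w measure" where
  "stopped_sigma M r \<alpha> T = filtration.pre_sigma (space M) (coeff_filtration M r \<alpha>) T"

end

theory Submission
  imports Defs
begin

text \<open>
  Fix \<open>n\<close> and let \<open>E\<^sub>n\<close> (\<open>epochs\<close>) be the set of degrees of the polynomials \<open>Q \<noteq> 0\<close> for which the
  coefficients of \<open>t\<^sup>-\<^sup>1, \<dots>, t\<^sup>-\<^sup>n\<close> vanish in every \<open>Q \<alpha>\<^sub>i\<close>. Gaussian elimination by leading terms shows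
  that \<open>|E\<^sub>n \<inter> [0, d)|\<close> is the dimension of the kernel of width \<open>d\<close>. If \<open>\<sigma>\<^sub>0 < \<sigma>\<^sub>1 < \<dots>\<close> enumerates \<open>E\<^sub>n\<close>,
  then \<open>L(n) = \<sigma>\<^sub>0 + 1\<close> and \<open>\<tau>\<^sub>n\<^sub>,\<^sub>j = \<sigma>\<^sub>j - \<sigma>\<^sub>0\<close>. Passing from \<open>n\<close> to \<open>n + 1\<close> imposes \<open>r\<close> further linear
  conditions, so \<open>E\<^sub>n\<^sub>+\<^sub>1 \<subseteq> E\<^sub>n\<close>, and at most \<open>r\<close> of the elements of \<open>E\<^sub>n\<close> below a given degree are lost.
  Hence \<open>min E\<^sub>n\<^sub>+\<^sub>1 = \<sigma>\<^sub>I\<close> for exactly one \<open>I\<close>, which satisfies \<open>I \<le> r\<close>; this \<open>I\<close> is the jump index, and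
  \<open>I = 0\<close> means that there is no jump. The deterministic claims follow, \<open>\<Delta> \<le> S + r\<close> being the bound
  \<open>L(n + 1) \<le> r (n + 1) + 1\<close>.

  For the probabilities, consider a degree \<open>d = \<sigma>\<^sub>j\<close> with no element of \<open>E\<^sub>n\<^sub>+\<^sub>1\<close> below it. All this is
  decided by \<open>u\<^sub>1, \<dots>, u\<^sub>n\<^sub>+\<^sub>d\<close>. A monic \<open>Q\<close> of degree \<open>d\<close> in the kernel for \<open>n\<close> also lies in the kernel
  for \<open>n + 1\<close> iff \<open>u\<^sub>n\<^sub>+\<^sub>d\<^sub>+\<^sub>1\<close> takes one value that depends on \<open>Q\<close> and on the past. There are \<open>q\<^sup>j\<close> such
  polynomials, and their values are distinct, because the difference of two polynomials with the same
  value would be a kernel element for \<open>n + 1\<close> of smaller degree. As \<open>u\<^sub>n\<^sub>+\<^sub>d\<^sub>+\<^sub>1\<close> is uniform on \<open>q\<^sup>r\<close>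
  vectors and independent of the past, \<open>\<sigma>\<^sub>j\<close> survives with conditional probability \<open>q\<^bsup>j-r\<^esup>\<close>
  (\<open>prob_epoch_survives\<close>). Multiplying over the successive \<open>\<sigma>\<^sub>1, \<sigma>\<^sub>2, \<dots>\<close> gives the stated law of \<open>I\<close>,
  on every event of the stopped sigma-algebra (\<open>prob_no_survival_before\<close>).

  The tail estimate is a first moment bound. A fixed monic polynomial lies in the kernel for \<open>n\<close> with
  probability \<open>q\<^bsup>-rn\<^esup>\<close>, so \<open>\<sigma>\<^sub>0 < d\<close> has probability at most \<open>(q\<^sup>d - 1) / ((q - 1) q\<^bsup>rn\<^esup>)\<close>. Given
  \<open>\<sigma>\<^sub>0\<close>, a jump has the fixed probability \<open>1 - q\<^bsup>-r\<^esup>\<close>, so conditioning on a jump leaves the law of \<open>\<sigma>\<^sub>0\<close>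
  unchanged; and \<open>\<Delta> \<ge> h\<close> forces \<open>\<sigma>\<^sub>0 < r n + r + 1 - h\<close>.
\<close>

section \<open>Kernels as spaces of polynomials\<close>

text \<open>
  A polynomial \<open>\<Sum>\<^sub>k \<theta>\<^sub>k t\<^sup>k\<close> of degree less than \<open>d\<close> is represented by the function \<open>\<theta>\<close> on all of
  \<^typ>\<open>nat\<close>, so that the kernels of different widths \<open>d\<close> are nested subsets of one type.
\<close>

definition Ker :: "nat \<Rightarrow> (nat \<Rightarrow> nat \<Rightarrow> 'a::{field,finite}) \<Rightarrow> nat \<Rightarrow> nat \<Rightarrow> (nat \<Rightarrow> 'a) set" where
  "Ker r u n d = {\<theta>. (\<forall>k\<ge>d. \<theta> k = 0) \<and>
     (\<forall>i\<in>{1..r}. \<forall>a\<in>{1..n}. (\<Sum>k<d. \<theta> k * u i (a + k)) = 0)}"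

definition epochs :: "nat \<Rightarrow> (nat \<Rightarrow> nat \<Rightarrow> 'a::{field,finite}) \<Rightarrow> nat \<Rightarrow> nat set" where
  "epochs r u n = {m. \<exists>\<theta>\<in>Ker r u n (Suc m). \<theta> m = 1}"

text \<open>
  Vectors in \<open>F\<^sub>q\<^sup>r\<close>, extended by 0 outside \<open>{1..r}\<close> so that equal vectors are equal functions.
\<close>

definition columns :: "nat \<Rightarrow> (nat \<Rightarrow> 'a::{field,finite}) set" where
  "columns r = {w. \<forall>i. i \<notin> {1..r} \<longrightarrow> w i = 0}"

text \<open>
  The coefficients of \<open>t\<close> to the power \<open>-(n + 1)\<close> in \<open>Q \<alpha>\<^sub>1, \<dots>, Q \<alpha>\<^sub>r\<close>, where the terms of \<open>Q\<close> of degree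
  at least \<open>d\<close> are ignored.
\<close>

definition next_coeffs :: "nat \<Rightarrow> (nat \<Rightarrow> nat \<Rightarrow> 'a::{field,finite}) \<Rightarrow> nat \<Rightarrow> nat \<Rightarrow> (nat \<Rightarrow> 'a) \<Rightarrow> nat \<Rightarrow> 'a" where
  "next_coeffs r u n d \<theta> = (\<lambda>i. if i \<in> {1..r} then \<Sum>k<d. \<theta> k * u i (Suc n + k) else 0)"

lemma bij_betw_supported_functions:
  "bij_betw (\<lambda>f k. if k \<in> I then f k else 0) (I \<rightarrow>\<^sub>E (UNIV :: 'a::zero set)) {\<theta>. \<forall>k. k \<notin> I \<longrightarrow> \<theta> k = 0}"
  by (rule bij_betw_byWitness[where f' = "\<lambda>\<theta>. restrict \<theta> I"])
     (auto simp: fun_eq_iff PiE_def extensional_def)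

lemma
  fixes I :: "'b set"
  assumes "finite I"
  shows finite_supported_functions: "finite {\<theta> :: 'b \<Rightarrow> 'a::{zero,finite}. \<forall>k. k \<notin> I \<longrightarrow> \<theta> k = 0}"
    and card_supported_functions:
      "card {\<theta> :: 'b \<Rightarrow> 'a::{zero,finite}. \<forall>k. k \<notin> I \<longrightarrow> \<theta> k = 0} = CARD('a) ^ card I"
proof -
  note bij = bij_betw_supported_functions[of I, where 'a='a]
  show "finite {\<theta> :: 'b \<Rightarrow> 'a. \<forall>k. k \<notin> I \<longrightarrow> \<theta> k = 0}"
    using bij_betw_finite[OF bij] assms by (simp add: finite_PiE)
  show "card {\<theta> :: 'b \<Rightarrow> 'a. \<forall>k. k \<notin> I \<longrightarrow> \<theta> k = 0} = CARD('a) ^ card I"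
    using bij_betw_same_card[OF bij] assms by (simp add: card_PiE)
qed

lemma finite_columns: "finite (columns r :: (nat \<Rightarrow> 'a::{field,finite}) set)"
  and card_columns: "card (columns r :: (nat \<Rightarrow> 'a::{field,finite}) set) = CARD('a) ^ r"
  unfolding columns_def
  by (simp_all only: finite_supported_functions card_supported_functions finite_atLeastAtMost card_atLeastAtMost)
     simp

lemma CARD_field_ge_2: "CARD('a::{field,finite}) \<ge> 2"
proof -
  have "card {0, 1 :: 'a} \<le> CARD('a)" by (rule card_mono) auto
  then show ?thesis by simp
qed

lemma Ker_sum_extend:
  fixes \<theta> :: "nat \<Rightarrow> 'a::{field,finite}"
  assumes "\<forall>k\<ge>d. \<theta> k = 0" "d \<le> d'"
  shows "(\<Sum>k<d'. \<theta> k * v k) = (\<Sum>k<d. \<theta> k * v k)"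
  using assms by (intro sum.mono_neutral_right) auto

lemma Ker_restrict_degree:
  assumes "d \<le> d'"
  shows "Ker r u n d = {\<theta>\<in>Ker r u n d'. \<forall>k\<ge>d. \<theta> k = 0}"
proof -
  have "(\<Sum>k<d'. \<theta> k * u i (a + k)) = (\<Sum>k<d. \<theta> k * u i (a + k))"
    if "\<forall>k\<ge>d. \<theta> k = 0" for \<theta> i a
    using that assms by (rule Ker_sum_extend)
  then show ?thesis using assms by (auto simp: Ker_def)
qed

lemma Ker_Suc:
  "Ker r u (Suc n) d = {\<theta>\<in>Ker r u n d. next_coeffs r u n d \<theta> = (\<lambda>_. 0)}"
proof -
  have "{1..Suc n} = insert (Suc n) {1..n}" by auto
  then show ?thesis by (auto simp: Ker_def next_coeffs_def fun_eq_iff)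
qed

lemma Ker_lincomb:
  assumes "\<theta> \<in> Ker r u n d" "\<eta> \<in> Ker r u n d"
  shows "(\<lambda>k. c * \<theta> k + \<eta> k) \<in> Ker r u n d"
proof -
  have "(\<Sum>k<d. (c * \<theta> k + \<eta> k) * u i (a + k)) =
      c * (\<Sum>k<d. \<theta> k * u i (a + k)) + (\<Sum>k<d. \<eta> k * u i (a + k))" for i a
    by (simp add: sum_distrib_left sum.distrib algebra_simps)
  then show ?thesis using assms by (auto simp: Ker_def)
qed

lemma Ker_zero: "(\<lambda>_. 0) \<in> Ker r u n d"
  by (auto simp: Ker_def)

lemma finite_Ker: "finite (Ker r u n d)"
proof (rule finite_subset)
  show "Ker r u n d \<subseteq> {\<theta>. \<forall>k. k \<notin> {..<d} \<longrightarrow> \<theta> k = 0}"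
    by (auto simp: Ker_def)
qed (rule finite_supported_functions, simp)

lemma next_coeffs_lincomb:
  "next_coeffs r u n d (\<lambda>k. c * \<theta> k + \<eta> k) = (\<lambda>i. c * next_coeffs r u n d \<theta> i + next_coeffs r u n d \<eta> i)"
  by (auto simp: next_coeffs_def fun_eq_iff sum_distrib_left sum.distrib algebra_simps)

text \<open>
  If a monic kernel element \<open>Q\<close> of degree \<open>d\<close> exists, subtracting multiples of it from the others
  splits the kernel of width \<open>d + 1\<close> as \<open>F\<^sub>q Q \<oplus>\<close> the kernel of width \<open>d\<close>. Otherwise rescaling shows that no
  kernel element has degree \<open>d\<close>, and the two kernels agree.
\<close>

lemma card_Ker_Suc_degree:
  fixes u :: "nat \<Rightarrow> nat \<Rightarrow> 'a::{field,finite}"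
  shows "card (Ker r u n (Suc d)) = (if d \<in> epochs r u n then CARD('a) else 1) * card (Ker r u n d)"
proof (cases "d \<in> epochs r u n")
  case True
  then obtain Q where Q: "Q \<in> Ker r u n (Suc d)" "Q d = 1"
    by (auto simp: epochs_def)
  have sub: "Ker r u n d = {\<theta>\<in>Ker r u n (Suc d). \<forall>k\<ge>d. \<theta> k = 0}"
    by (rule Ker_restrict_degree) simp
  have top: "\<theta> k = 0" if "\<theta> \<in> Ker r u n (Suc d)" "k > d" for \<theta> k
    using that by (auto simp: Ker_def)
  \<comment> \<open>The scalar \<open>c\<close> is the coefficient of degree \<open>d\<close>, since \<open>Q\<close> is monic.\<close>
  have "bij_betw (\<lambda>(c, \<theta>) k. c * Q k + \<theta> k) (UNIV \<times> Ker r u n d) (Ker r u n (Suc d))"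
  proof (rule bij_betw_byWitness[where f' = "\<lambda>\<theta>. (\<theta> d, \<lambda>k. - \<theta> d * Q k + \<theta> k)"])
    show "\<forall>x\<in>UNIV \<times> Ker r u n d. (\<lambda>\<theta>. (\<theta> d, \<lambda>k. - \<theta> d * Q k + \<theta> k)) ((\<lambda>(c, \<theta>) k. c * Q k + \<theta> k) x) = x"
      using Q by (auto simp: sub)
    show "(\<lambda>(c, \<theta>) k. c * Q k + \<theta> k) ` (UNIV \<times> Ker r u n d) \<subseteq> Ker r u n (Suc d)"
      using Ker_lincomb[OF Q(1)] by (auto simp: sub)
    show "(\<lambda>\<theta>. (\<theta> d, \<lambda>k. - \<theta> d * Q k + \<theta> k)) ` Ker r u n (Suc d) \<subseteq> UNIV \<times> Ker r u n d"
    proof safe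
      fix \<theta> assume \<theta>: "\<theta> \<in> Ker r u n (Suc d)"
      have "- \<theta> d * Q k + \<theta> k = 0" if "k \<ge> d" for k
        using that Q top[OF Q(1), of k] top[OF \<theta>, of k] by (cases "k = d") auto
      then show "(\<lambda>k. - \<theta> d * Q k + \<theta> k) \<in> Ker r u n d"
        using Ker_lincomb[OF Q(1) \<theta>, of "- \<theta> d"] unfolding sub by blast
    qed simp
  qed auto
  from bij_betw_same_card[OF this] True show ?thesis
    by (simp add: card_cartesian_product)
next
  case False
  have "Ker r u n (Suc d) = Ker r u n d"
  proof -
    have "\<theta> d = 0" if \<theta>: "\<theta> \<in> Ker r u n (Suc d)" for \<theta>
    proof (rule ccontr)
      assume nz: "\<theta> d \<noteq> 0"
      have "(\<lambda>k. inverse (\<theta> d) * \<theta> k + 0) \<in> Ker r u n (Suc d)"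
        using Ker_lincomb[OF \<theta> Ker_zero] .
      with nz have "d \<in> epochs r u n"
        unfolding epochs_def by (intro CollectI bexI) auto
      with False show False by contradiction
    qed
    moreover have "\<theta> k = 0" if "\<theta> \<in> Ker r u n (Suc d)" "k \<ge> Suc d" for \<theta> k
      using that by (auto simp: Ker_def)
    ultimately show ?thesis
      unfolding Ker_restrict_degree[of d "Suc d", simplified]
      by (auto simp: le_eq_less_or_eq[of d] Suc_le_eq)
  qed
  with False show ?thesis by simp
qed

lemma card_Ker:
  fixes u :: "nat \<Rightarrow> nat \<Rightarrow> 'a::{field,finite}"
  shows "card (Ker r u n d) = CARD('a) ^ card (epochs r u n \<inter> {..<d})"
proof (induction d)
  case 0
  have "Ker r u n 0 = {\<lambda>_. 0}" by (auto simp: Ker_def)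
  then show ?case by simp
next
  case (Suc d)
  then show ?case
    by (simp add: card_Ker_Suc_degree lessThan_Suc Int_insert_right)
qed

lemma epochs_antimono: "epochs r u (Suc n) \<subseteq> epochs r u n"
  unfolding epochs_def Ker_Suc by auto

text \<open>
  The kernel for \<open>n + 1\<close> is the zero fibre of the linear map \<^const>\<open>next_coeffs\<close> into a space with
  \<open>q\<^sup>r\<close> elements, and every nonempty fibre is a translate of the zero fibre.
\<close>

lemma card_Ker_Suc_le:
  fixes u :: "nat \<Rightarrow> nat \<Rightarrow> 'a::{field,finite}"
  shows "card (Ker r u n d) \<le> CARD('a) ^ r * card (Ker r u (Suc n) d)"
proof -
  let ?e = "next_coeffs r u n d"
  let ?F = "\<lambda>w. {\<theta>\<in>Ker r u n d. ?e \<theta> = w}"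
  have fib: "card (?F w) \<le> card (Ker r u (Suc n) d)" for w
  proof (cases "?F w = {}")
    case False
    then obtain \<eta> where \<eta>: "\<eta> \<in> Ker r u n d" "?e \<eta> = w" by auto
    show ?thesis
    proof (rule card_inj_on_le)
      show "inj_on (\<lambda>\<theta> k. (-1) * \<eta> k + \<theta> k) (?F w)"
        by (auto simp: inj_on_def fun_eq_iff)
      show "(\<lambda>\<theta> k. (-1) * \<eta> k + \<theta> k) ` ?F w \<subseteq> Ker r u (Suc n) d"
      proof (rule image_subsetI)
        fix \<theta> assume "\<theta> \<in> ?F w"
        with \<eta> show "(\<lambda>k. (-1) * \<eta> k + \<theta> k) \<in> Ker r u (Suc n) d"
          unfolding Ker_Suc using Ker_lincomb[of \<eta> r u n d \<theta> "-1"]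
          by (simp add: next_coeffs_lincomb[of _ _ _ _ "-1", simplified] fun_eq_iff)
      qed
    qed (rule finite_Ker)
  qed (simp only: card.empty)
  have "Ker r u n d \<subseteq> (\<Union>w\<in>columns r. ?F w)"
    by (auto simp: columns_def next_coeffs_def)
  then have "card (Ker r u n d) \<le> card (\<Union>w\<in>columns r. ?F w)"
    by (intro card_mono finite_UN_I finite_columns) (auto simp: finite_Ker)
  also have "\<dots> \<le> (\<Sum>w\<in>columns r. card (?F w))"
    by (rule card_UN_le[OF finite_columns])
  also have "\<dots> \<le> (\<Sum>w\<in>(columns r :: (nat \<Rightarrow> 'a) set). card (Ker r u (Suc n) d))"
    by (rule sum_mono) (rule fib)
  also have "\<dots> = CARD('a) ^ r * card (Ker r u (Suc n) d)"
    by (simp add: card_columns)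
  finally show ?thesis .
qed

lemma card_epochs_Suc_le:
  fixes u :: "nat \<Rightarrow> nat \<Rightarrow> 'a::{field,finite}"
  shows "card (epochs r u n \<inter> {..<d}) \<le> r + card (epochs r u (Suc n) \<inter> {..<d})"
proof -
  have "CARD('a) ^ card (epochs r u n \<inter> {..<d}) \<le>
      CARD('a) ^ (r + card (epochs r u (Suc n) \<inter> {..<d}))"
    using card_Ker_Suc_le[of r u n d] unfolding card_Ker by (simp add: power_add)
  then show ?thesis
    using CARD_field_ge_2[where 'a='a] by (subst (asm) power_increasing_iff) auto
qed

text \<open>
  Rank and nullity: \<open>r n\<close> linear conditions are imposed on \<open>d\<close> coefficients.
\<close>

lemma card_epochs_ge:
  fixes u :: "nat \<Rightarrow> nat \<Rightarrow> 'a::{field,finite}"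
  shows "d \<le> r * n + card (epochs r u n \<inter> {..<d})"
proof (induction n)
  case 0
  have "(\<lambda>k. if k = m then 1 else 0) \<in> Ker r u 0 (Suc m)" for m
    by (auto simp: Ker_def)
  then have "epochs r u 0 = UNIV"
    unfolding epochs_def by (fastforce intro: bexI[rotated])
  then show ?case by simp
next
  case (Suc n)
  then show ?case using card_epochs_Suc_le[of r u n d] by simp
qed

lemma infinite_epochs: "infinite (epochs r u n)"
proof
  assume fin: "finite (epochs r u n)"
  define d where "d = r * n + card (epochs r u n) + 1"
  have "card (epochs r u n \<inter> {..<d}) \<le> card (epochs r u n)"
    using fin by (intro card_mono) auto
  with card_epochs_ge[of d r n u] show False by (simp add: d_def)
qed

section \<open>The epochs in increasing order\<close>

lemma Int_lessThan_enumerate: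
  fixes S :: "nat set"
  assumes "infinite S"
  shows "S \<inter> {..<enumerate S j} = enumerate S ` {..<j}"
proof safe
  fix s assume "s \<in> S" "s < enumerate S j"
  moreover obtain k where "enumerate S k = s"
    using enumerate_Ex \<open>s \<in> S\<close> assms by blast
  ultimately show "s \<in> enumerate S ` {..<j}" using assms by auto
qed (use assms enumerate_in_set in auto)

lemma card_Int_lessThan_enumerate:
  fixes S :: "nat set"
  assumes "infinite S"
  shows "card (S \<inter> {..<enumerate S j}) = j"
  unfolding Int_lessThan_enumerate[OF assms]
  using inj_enumerate[OF assms] by (simp add: card_image inj_on_subset)

abbreviation epoch_degree :: "nat \<Rightarrow> (nat \<Rightarrow> nat \<Rightarrow> 'a::{field,finite}) \<Rightarrow> nat \<Rightarrow> nat \<Rightarrow> nat" where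
  "epoch_degree r u n j \<equiv> enumerate (epochs r u n) j"

abbreviation laurent_coeffs :: "(nat \<Rightarrow> 'a::{field,finite} fls) \<Rightarrow> nat \<Rightarrow> nat \<Rightarrow> 'a" where
  "laurent_coeffs x \<equiv> (\<lambda>i j. fls_nth (x i) (int j))"

lemma card_below_epoch_degree: "card (epochs r u n \<inter> {..<epoch_degree r u n j}) = j"
  by (rule card_Int_lessThan_enumerate[OF infinite_epochs])

lemma epoch_degree_in: "epoch_degree r u n j \<in> epochs r u n"
  by (rule enumerate_in_set[OF infinite_epochs])

lemma epoch_degree_inject: "epoch_degree r u n i = epoch_degree r u n j \<longleftrightarrow> i = j"
  using inj_enumerate[OF infinite_epochs] by (auto dest: injD)

lemma epoch_degree_eq_iff:
  "epoch_degree r u n j = d \<longleftrightarrow> d \<in> epochs r u n \<and> card (epochs r u n \<inter> {..<d}) = j"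
  using enumerate_Ex[OF infinite_epochs, of d r u n] card_below_epoch_degree epoch_degree_in by metis

lemma epoch_degree_0_less_iff: "epoch_degree r u n 0 < d \<longleftrightarrow> epochs r u n \<inter> {..<d} \<noteq> {}"
proof
  show "epochs r u n \<inter> {..<d} \<noteq> {}" if "epoch_degree r u n 0 < d"
    using that epoch_degree_in by blast
  show "epoch_degree r u n 0 < d" if "epochs r u n \<inter> {..<d} \<noteq> {}"
    using that by (auto simp: enumerate_0 intro: Least_le order.strict_trans1)
qed

lemma epoch_degree_le: "epoch_degree r u n j \<le> r * n + j"
  using card_epochs_ge[of "epoch_degree r u n j" r n u] by (simp add: card_below_epoch_degree)

text \<open>
  The bound \<open>i \<le> r\<close> holds because all \<open>i\<close> epochs below the first surviving one are lost, while the step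
  from \<open>n\<close> to \<open>n + 1\<close> loses at most \<open>r\<close> of them.
\<close>

lemma first_epoch_Suc: "\<exists>i\<le>r. epoch_degree r u (Suc n) 0 = epoch_degree r u n i"
proof -
  have "epoch_degree r u (Suc n) 0 \<in> epochs r u n"
    using epoch_degree_in epochs_antimono by blast
  then obtain i where i: "epoch_degree r u n i = epoch_degree r u (Suc n) 0"
    using enumerate_Ex[OF infinite_epochs] by blast
  have "i \<le> r"
    using card_epochs_Suc_le[of r u n "epoch_degree r u (Suc n) 0"]
      card_below_epoch_degree[of r u n i] card_below_epoch_degree[of r u "Suc n" 0] i by simp
  with i show ?thesis by auto
qed

section \<open>The Hankel matrices in terms of epochs\<close>

text \<open>
  Over a finite field a dimension can be read off from a cardinality; this gives access to
  \<^const>\<open>kernel_dim\<close> by counting, without constructing bases.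
\<close>

lemma (in vectorspace) card_carrier_eq_power_dim:
  assumes "finite (carrier K)" "finite (carrier V)"
  shows "card (carrier V) = card (carrier K) ^ dim"
proof -
  have "fin_dim"
    unfolding fin_dim_def
  proof (intro exI conjI)
    show "finite (carrier V)" by fact
    show "carrier V \<subseteq> carrier V" ..
    show "gen_set (carrier V)"
      using in_own_span[of "carrier V"] span_is_subset2[of "carrier V"] by blast
  qed
  then obtain B where B: "finite B" "basis B"
    using finite_basis_exists by blast
  then have BV: "B \<subseteq> carrier V" by (simp add: basis_def)
  have "bij_betw (\<lambda>a. lincomb a B) (B \<rightarrow>\<^sub>E carrier K) (carrier V)"
  proof (rule bij_betwI')
    have ex1: "\<exists>!a. a \<in> B \<rightarrow>\<^sub>E carrier K \<and> lincomb a B = v" if "v \<in> carrier V" for v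
      using basis_criterion[OF B(1) BV] B(2) that by blast
    have closed: "lincomb a B \<in> carrier V" if "a \<in> B \<rightarrow>\<^sub>E carrier K" for a
      using that BV by (intro lincomb_closed) auto
    show "(lincomb a B = lincomb b B) = (a = b)"
      if "a \<in> B \<rightarrow>\<^sub>E carrier K" "b \<in> B \<rightarrow>\<^sub>E carrier K" for a b
      using ex1[OF closed[OF that(1)]] that by auto
    show "lincomb a B \<in> carrier V" if "a \<in> B \<rightarrow>\<^sub>E carrier K" for a
      using closed[OF that] .
    show "\<exists>a\<in>B \<rightarrow>\<^sub>E carrier K. v = lincomb a B" if "v \<in> carrier V" for v
      using ex1[OF that] by auto
  qed
  from bij_betw_same_card[OF this] B show ?thesis
    by (simp add: card_PiE dim_basis)
qed

lemma card_mat_kernel: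
  fixes A :: "'a::{field,finite} mat"
  shows "card (mat_kernel A) = CARD('a) ^ kernel_dim A"
proof -
  interpret kernel "dim_row A" "dim_col A" A by unfold_locales simp
  have inj: "inj_on (\<lambda>v. (\<lambda>k. if k < dim_col A then v $ k else 0)) (carrier_vec (dim_col A) :: 'a vec set)"
    by (rule inj_onI) (auto simp: fun_eq_iff intro!: eq_vecI, metis)
  have "finite (carrier_vec (dim_col A) :: 'a vec set)"
    by (rule inj_on_finite[OF inj _ finite_supported_functions[of "{..<dim_col A}"]]) auto
  then have "finite (mat_kernel A)"
    by (rule rev_finite_subset) (auto simp: mat_kernel_def)
  then show ?thesis
    using Ker.card_carrier_eq_power_dim by simp
qed

text \<open>
  Division with remainder by \<open>n\<close> matches the row \<open>l < r n\<close> with the pair of a block \<open>i\<close> and a row \<open>a\<close> in it.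
\<close>

lemma bij_betw_hankel_kernel:
  fixes x :: "nat \<Rightarrow> 'a::{field,finite} fls"
  shows "bij_betw (\<lambda>v k. if k < d then v $ k else 0)
    (mat_kernel (hankel_stack r x n d)) (Ker r (laurent_coeffs x) n d)"
proof -
  let ?u = "\<lambda>i j. fls_nth (x i) (int j)"
  let ?f = "\<lambda>(v::'a vec) k. if k < d then v $ k else 0"
  have mult: "(hankel_stack r x n d *\<^sub>v v) $ l = (\<Sum>k<d. ?f v k * ?u (l div n + 1) (l mod n + 1 + k))"
    if "v \<in> carrier_vec d" "l < r * n" for v l
    using that by (auto simp: hankel_stack_def scalar_prod_def lessThan_atLeast0 algebra_simps intro!: sum.cong)
  have iff: "v \<in> mat_kernel (hankel_stack r x n d) \<longleftrightarrow> ?f v \<in> Ker r ?u n d" if v: "v \<in> carrier_vec d" for v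
  proof -
    have "v \<in> mat_kernel (hankel_stack r x n d) \<longleftrightarrow> (\<forall>l<r*n. (hankel_stack r x n d *\<^sub>v v) $ l = 0)"
    proof -
      have "v \<in> mat_kernel (hankel_stack r x n d) \<longleftrightarrow> hankel_stack r x n d *\<^sub>v v = 0\<^sub>v (r * n)"
        using v by (simp add: mat_kernel_def hankel_stack_def)
      moreover have "dim_vec (hankel_stack r x n d *\<^sub>v v) = r * n"
        by (simp add: hankel_stack_def)
      ultimately show ?thesis by (metis eq_vecI index_zero_vec)
    qed
    also have "\<dots> \<longleftrightarrow> (\<forall>l<r*n. (\<Sum>k<d. ?f v k * ?u (l div n + 1) (l mod n + 1 + k)) = 0)"
      using mult[OF v] by simp
    also have "\<dots> \<longleftrightarrow> (\<forall>i\<in>{1..r}. \<forall>a\<in>{1..n}. (\<Sum>k<d. ?f v k * ?u i (a + k)) = 0)"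
    proof (intro iffI ballI allI impI)
      fix i a assume *: "\<forall>l<r*n. (\<Sum>k<d. ?f v k * ?u (l div n + 1) (l mod n + 1 + k)) = 0"
        and i: "i \<in> {1..r}" and a: "a \<in> {1..n}"
      define l where "l = (i - 1) * n + (a - 1)"
      have "a - 1 < n" using a by auto
      then have "l div n = i - 1" "l mod n = a - 1" unfolding l_def by simp_all
      moreover have "l < r * n"
      proof -
        have "l < (i - 1) * n + n" using a by (auto simp: l_def)
        also have "\<dots> = i * n" using i by (cases i) auto
        also have "\<dots> \<le> r * n" using i by simp
        finally show ?thesis .
      qed
      ultimately show "(\<Sum>k<d. ?f v k * ?u i (a + k)) = 0"
        using *[rule_format, of l] i a by simp
    next
      fix l assume *: "\<forall>i\<in>{1..r}. \<forall>a\<in>{1..n}. (\<Sum>k<d. ?f v k * ?u i (a + k)) = 0" and l: "l < r * n"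
      then have "n > 0" by (cases n) auto
      then have "l div n < r" "l mod n < n" using l by (auto simp: less_mult_imp_div_less)
      then show "(\<Sum>k<d. ?f v k * ?u (l div n + 1) (l mod n + 1 + k)) = 0"
        by (intro *[rule_format]) auto
    qed
    finally show ?thesis by (simp add: Ker_def)
  qed
  show ?thesis
  proof (rule bij_betw_byWitness[where f' = "\<lambda>\<theta>. vec d \<theta>"])
    have sub: "mat_kernel (hankel_stack r x n d) \<subseteq> carrier_vec d"
      by (auto simp: mat_kernel_def hankel_stack_def)
    show "\<forall>v\<in>mat_kernel (hankel_stack r x n d). vec d (?f v) = v"
      using sub by (auto intro!: eq_vecI)
    show recover: "\<forall>\<theta>\<in>Ker r ?u n d. ?f (vec d \<theta>) = \<theta>"
      by (auto simp: Ker_def fun_eq_iff)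
    show "?f ` mat_kernel (hankel_stack r x n d) \<subseteq> Ker r ?u n d"
      using iff sub by blast
    show "vec d ` Ker r ?u n d \<subseteq> mat_kernel (hankel_stack r x n d)"
      using iff[of "vec d _"] recover by auto
  qed
qed

lemma kernel_dim_hankel:
  fixes x :: "nat \<Rightarrow> 'a::{field,finite} fls"
  shows "kernel_dim (hankel_stack r x n d) = card (epochs r (laurent_coeffs x) n \<inter> {..<d})"
proof -
  have "CARD('a) ^ kernel_dim (hankel_stack r x n d) =
      CARD('a) ^ card (epochs r (laurent_coeffs x) n \<inter> {..<d})"
    unfolding card_mat_kernel[symmetric] card_Ker[symmetric]
    by (rule bij_betw_same_card[OF bij_betw_hankel_kernel])
  then show ?thesis
    using CARD_field_ge_2[where 'a='a] by (subst (asm) power_inject_exp) auto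
qed

lemma mat_kernel_nontrivial_iff:
  fixes x :: "nat \<Rightarrow> 'a::{field,finite} fls"
  shows "mat_kernel (hankel_stack r x n d) \<noteq> {0\<^sub>v d} \<longleftrightarrow>
    epochs r (laurent_coeffs x) n \<inter> {..<d} \<noteq> {}"
proof -
  let ?A = "hankel_stack r x n d"
  have zero: "0\<^sub>v d \<in> mat_kernel ?A"
    by (auto simp: mat_kernel_def hankel_stack_def)
  have "mat_kernel ?A = {0\<^sub>v d} \<longleftrightarrow> card (mat_kernel ?A) = 1"
    using zero by (auto simp: card_1_singleton_iff)
  also have "\<dots> \<longleftrightarrow> kernel_dim ?A = 0"
    unfolding card_mat_kernel using CARD_field_ge_2[where 'a='a] by simp
  also have "\<dots> \<longleftrightarrow> epochs r (laurent_coeffs x) n \<inter> {..<d} = {}"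
    unfolding kernel_dim_hankel by simp
  finally show ?thesis by simp
qed

lemma Lmin_eq: "Lmin r x n = Suc (epoch_degree r (laurent_coeffs x) n 0)"
  unfolding Lmin_def mat_kernel_nontrivial_iff epoch_degree_0_less_iff[symmetric]
  by (rule Least_equality) auto

lemma nu_eq: "nu r x n k = card (epochs r (laurent_coeffs x) n \<inter> {..epoch_degree r (laurent_coeffs x) n 0 + k})"
  by (simp add: nu_def Lmin_eq kernel_dim_hankel lessThan_Suc_atMost)

text \<open>
  The dimension of the kernel of width \<open>D\<^sub>n + k\<close> reaches \<open>j + 1\<close> as soon as that width exceeds the degree
  of the epoch with index \<open>j\<close>, counted from 0.
\<close>

lemma tau_eq:
  assumes "j \<ge> 1"
  shows "tau r x n j = epoch_degree r (laurent_coeffs x) n j - epoch_degree r (laurent_coeffs x) n 0"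
proof -
  let ?E = "epochs r (laurent_coeffs x) n"
  let ?s = "epoch_degree r (laurent_coeffs x) n"
  have lt: "?s 0 < ?s j" using assms by (simp add: infinite_epochs)
  have "tau r x n j = (LEAST k. k \<ge> 1 \<and> nu r x n k = j + 1)"
    by (simp add: tau_def Inf_nat_def)
  also have "\<dots> = ?s j - ?s 0"
  proof (rule Least_equality, intro conjI)
    show "?s j - ?s 0 \<ge> 1" using lt by simp
    have "?E \<inter> {..?s j} = insert (?s j) (?E \<inter> {..<?s j})"
      using epoch_degree_in[of r "laurent_coeffs x" n j] by auto
    then show "nu r x n (?s j - ?s 0) = j + 1"
      using lt by (simp add: nu_eq card_below_epoch_degree)
  next
    fix k assume k: "k \<ge> 1 \<and> nu r x n k = j + 1"
    show "?s j - ?s 0 \<le> k"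
    proof (rule ccontr)
      assume "\<not> ?thesis"
      then have "?E \<inter> {..?s 0 + k} \<subseteq> ?E \<inter> {..<?s j}" by auto
      then have "nu r x n k \<le> card (?E \<inter> {..<?s j})"
        unfolding nu_eq by (intro card_mono) auto
      with k show False by (simp add: card_below_epoch_degree)
    qed
  qed
  finally show ?thesis .
qed

lemma Lmin_le: "Lmin r x n \<le> r * n + 1"
  using epoch_degree_le[of r "laurent_coeffs x" n 0] by (simp add: Lmin_eq)

lemma jump_eq_0_iff:
  "jump r x n = 0 \<longleftrightarrow> epoch_degree r (laurent_coeffs x) (Suc n) 0 = epoch_degree r (laurent_coeffs x) n 0"
  using first_epoch_Suc[of r "laurent_coeffs x" n] by (auto simp: jump_def Lmin_eq infinite_epochs)

lemma Delta_eq_tau_iff: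
  assumes "i \<ge> 1"
  shows "Delta r x n = int (tau r x n i) \<longleftrightarrow>
    epoch_degree r (laurent_coeffs x) (Suc n) 0 = epoch_degree r (laurent_coeffs x) n i"
proof -
  have "epoch_degree r (laurent_coeffs x) n 0 \<le> epoch_degree r (laurent_coeffs x) n i"
    by (simp add: infinite_epochs)
  then show ?thesis
    using tau_eq[OF assms, of r x n] by (auto simp: Delta_def Lmin_eq)
qed

lemma ex1_jump_index:
  assumes "jump r x n = 1"
  shows "\<exists>!i. i \<in> {1..r} \<and> Delta r x n = int (tau r x n i)"
proof -
  obtain i where i: "i \<le> r"
    "epoch_degree r (laurent_coeffs x) (Suc n) 0 = epoch_degree r (laurent_coeffs x) n i"
    using first_epoch_Suc by blast
  moreover have "i \<noteq> 0"
    using assms i jump_eq_0_iff[of r x n] by (metis zero_neq_one)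
  ultimately show ?thesis
    by (intro ex1I[of _ i]) (auto simp: Delta_eq_tau_iff Suc_le_eq epoch_degree_inject)
qed

text \<open>
  This characterization covers the value 0 of the index as well, so that jumps and non-jumps can be
  treated alike.
\<close>

lemma jump_index_eq_iff:
  "jump_index r x n = j \<longleftrightarrow>
    epoch_degree r (laurent_coeffs x) (Suc n) 0 = epoch_degree r (laurent_coeffs x) n j"
proof (cases "jump r x n = 0")
  case True
  then show ?thesis
    using jump_eq_0_iff[of r x n] by (auto simp: jump_index_def epoch_degree_inject)
next
  case False
  then have "jump r x n = 1" by (simp add: jump_def split: if_splits)
  then have "jump_index r x n \<in> {1..r} \<and> Delta r x n = int (tau r x n (jump_index r x n))"
    using theI'[OF ex1_jump_index] False unfolding jump_index_def by (simp only: if_False)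
  then show ?thesis
    using Delta_eq_tau_iff[of "jump_index r x n" r x n] by (simp add: epoch_degree_inject)
qed

lemma Delta_le_slack: "Delta r x n \<le> slack r x n + int r"
proof -
  have "int (Lmin r x (n + 1)) \<le> int (r * (n + 1) + 1)"
    by (simp only: of_nat_le_iff Lmin_le)
  then show ?thesis by (simp add: Delta_def slack_def algebra_simps)
qed

section \<open>Quantities determined by the first coefficient vectors\<close>

definition trunc :: "nat \<Rightarrow> nat \<Rightarrow> (nat \<Rightarrow> nat \<Rightarrow> 'a::zero) \<Rightarrow> nat \<Rightarrow> nat \<Rightarrow> 'a" where
  "trunc r N u = (\<lambda>i j. if i \<in> {1..r} \<and> j \<in> {1..N} then u i j else 0)"

text \<open>
  \<open>f\<close> depends only on \<open>u\<^sub>1, \<dots>, u\<^sub>N\<close>. For predicates this is membership in the sigma-algebra \<open>F\<^sub>N\<close>,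
  expressed without a probability space (\<open>sets_coeff_filtration\<close> below).
\<close>

definition known :: "nat \<Rightarrow> nat \<Rightarrow> ((nat \<Rightarrow> nat \<Rightarrow> 'a::zero) \<Rightarrow> 'b) \<Rightarrow> bool" where
  "known r N f \<longleftrightarrow> (\<forall>u. f (trunc r N u) = f u)"

definition coeff_column :: "nat \<Rightarrow> nat \<Rightarrow> (nat \<Rightarrow> nat \<Rightarrow> 'a::zero) \<Rightarrow> nat \<Rightarrow> 'a" where
  "coeff_column r j u = (\<lambda>i. if i \<in> {1..r} then u i j else 0)"

lemma trunc_trunc: "N \<le> N' \<Longrightarrow> trunc r N (trunc r N' u) = trunc r N u"
  by (auto simp: trunc_def fun_eq_iff)

lemma known_mono: "known r N f \<Longrightarrow> N \<le> N' \<Longrightarrow> known r N' f"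
  unfolding known_def by (metis trunc_trunc)

lemma knownD: "known r N f \<Longrightarrow> f (trunc r N u) = f u"
  by (simp add: known_def)

lemma known_const: "known r N (\<lambda>u. c)"
  by (simp add: known_def)

lemma known_comp: "known r N f \<Longrightarrow> known r N (\<lambda>u. g (f u))"
  by (simp add: known_def)

lemma finite_range_trunc:
  "finite (range (trunc r N :: (nat \<Rightarrow> nat \<Rightarrow> 'a::{zero,finite}) \<Rightarrow> _))"
proof -
  have "finite {w :: nat \<times> nat \<Rightarrow> 'a. \<forall>p. p \<notin> {1..r} \<times> {1..N} \<longrightarrow> w p = 0}"
    by (rule finite_supported_functions) simp
  then have "finite (curry ` {w :: nat \<times> nat \<Rightarrow> 'a. \<forall>p. p \<notin> {1..r} \<times> {1..N} \<longrightarrow> w p = 0})"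
    by (rule finite_imageI)
  moreover have "trunc r N u \<in> curry ` {w :: nat \<times> nat \<Rightarrow> 'a. \<forall>p. p \<notin> {1..r} \<times> {1..N} \<longrightarrow> w p = 0}" for u
    by (rule image_eqI[of _ _ "case_prod (trunc r N u)"]) (auto simp: trunc_def)
  ultimately show ?thesis by (auto intro: finite_subset)
qed

lemma known_Ker:
  assumes "n + d \<le> Suc N"
  shows "known r N (\<lambda>u :: nat \<Rightarrow> nat \<Rightarrow> 'a::{field,finite}. Ker r u n d)"
proof -
  have "(\<Sum>k<d. \<theta> k * trunc r N u i (a + k)) = (\<Sum>k<d. \<theta> k * u i (a + k))"
    if "i \<in> {1..r}" "a \<in> {1..n}" for \<theta> :: "nat \<Rightarrow> 'a" and u i a
    using that assms by (intro sum.cong) (auto simp: trunc_def)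
  then show ?thesis
    unfolding known_def Ker_def by (simp cong: ball_cong del: One_nat_def atLeastAtMost_iff)
qed

lemma known_next_coeffs:
  assumes "n + d \<le> N"
  shows "known r N (\<lambda>u :: nat \<Rightarrow> nat \<Rightarrow> 'a::{field,finite}. next_coeffs r u n d)"
proof -
  have "(\<Sum>k<d. \<theta> k * trunc r N u i (Suc n + k)) = (\<Sum>k<d. \<theta> k * u i (Suc n + k))"
    if "i \<in> {1..r}" for \<theta> :: "nat \<Rightarrow> 'a" and u i
    using that assms by (intro sum.cong) (auto simp: trunc_def)
  then show ?thesis by (auto simp: known_def next_coeffs_def fun_eq_iff)
qed

text \<open>
  A kernel element of degree less than \<open>d\<close> involves \<open>u\<^sub>a\<^sub>+\<^sub>k\<close> with \<open>a \<le> n\<close> and \<open>k < d\<close> only. For \<open>d = 0\<close>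
  nothing has to be known, even if \<open>n > N + 1\<close>.
\<close>

lemma known_epochs_below:
  assumes "n + d \<le> Suc N \<or> d = 0"
  shows "known r N (\<lambda>u :: nat \<Rightarrow> nat \<Rightarrow> 'a::{field,finite}. epochs r u n \<inter> {..<d})"
proof -
  have "Ker r (trunc r N u) n (Suc m) = Ker r u n (Suc m)" if "m < d" for u :: "nat \<Rightarrow> nat \<Rightarrow> 'a" and m
    using that assms by (intro knownD[OF known_Ker]) auto
  then show ?thesis
    unfolding known_def by (auto simp: epochs_def)
qed

lemma known_epoch_degree_eq:
  assumes "n + d \<le> N"
  shows "known r N (\<lambda>u :: nat \<Rightarrow> nat \<Rightarrow> 'a::{field,finite}. epoch_degree r u n j = d)"
proof -
  have "epoch_degree r u n j = d \<longleftrightarrow>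
      d \<in> epochs r u n \<inter> {..<Suc d} \<and> card (epochs r u n \<inter> {..<d}) = j" for u :: "nat \<Rightarrow> nat \<Rightarrow> 'a"
    by (auto simp: epoch_degree_eq_iff)
  moreover have "epochs r (trunc r N u) n \<inter> {..<Suc d} = epochs r u n \<inter> {..<Suc d}"
    and "epochs r (trunc r N u) n \<inter> {..<d} = epochs r u n \<inter> {..<d}" for u :: "nat \<Rightarrow> nat \<Rightarrow> 'a"
    using assms by (auto intro!: knownD[OF known_epochs_below] simp del: Int_iff)
  ultimately show ?thesis unfolding known_def by (simp only: simp_thms)
qed

lemma known_first_epoch_less:
  assumes "n + d \<le> Suc N \<or> d = 0"
  shows "known r N (\<lambda>u :: nat \<Rightarrow> nat \<Rightarrow> 'a::{field,finite}. epoch_degree r u n 0 < d)"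
  unfolding epoch_degree_0_less_iff
  by (rule known_comp[OF known_epochs_below[OF assms]])

section \<open>Survival of an epoch in terms of one fresh coefficient vector\<close>

definition monics :: "nat \<Rightarrow> (nat \<Rightarrow> nat \<Rightarrow> 'a::{field,finite}) \<Rightarrow> nat \<Rightarrow> nat \<Rightarrow> (nat \<Rightarrow> 'a) set" where
  "monics r u n d = {\<theta>\<in>Ker r u n (Suc d). \<theta> d = 1}"

lemma mem_epochs_iff: "d \<in> epochs r u n \<longleftrightarrow> monics r u n d \<noteq> {}"
  by (auto simp: epochs_def monics_def)

lemma card_monics:
  assumes "d \<in> epochs r u n"
  shows "card (monics r u n d) = card (Ker r u n d)"
proof -
  obtain Q where Q: "Q \<in> Ker r u n (Suc d)" "Q d = 1"
    using assms by (auto simp: epochs_def)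
  have sub: "Ker r u n d = {\<theta>\<in>Ker r u n (Suc d). \<forall>k\<ge>d. \<theta> k = 0}"
    by (rule Ker_restrict_degree) simp
  have top: "\<theta> k = 0" if "\<theta> \<in> Ker r u n (Suc d)" "k > d" for \<theta> k
    using that by (auto simp: Ker_def)
  have "bij_betw (\<lambda>\<theta> k. 1 * Q k + \<theta> k) (Ker r u n d) (monics r u n d)"
  proof (rule bij_betw_byWitness[where f' = "\<lambda>\<theta> k. (-1) * Q k + \<theta> k"])
    show "(\<lambda>\<theta> k. 1 * Q k + \<theta> k) ` Ker r u n d \<subseteq> monics r u n d"
      using Ker_lincomb[OF Q(1), of _ 1] Q by (auto simp: sub monics_def)
    show "(\<lambda>\<theta> k. (-1) * Q k + \<theta> k) ` monics r u n d \<subseteq> Ker r u n d"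
    proof (rule image_subsetI)
      fix \<theta> assume \<theta>: "\<theta> \<in> monics r u n d"
      then have "(-1) * Q k + \<theta> k = 0" if "k \<ge> d" for k
        using that Q top[OF Q(1), of k] top[of \<theta> k] by (cases "k = d") (auto simp: monics_def)
      then show "(\<lambda>k. (-1) * Q k + \<theta> k) \<in> Ker r u n d"
        using Ker_lincomb[OF Q(1), of \<theta> "-1"] \<theta> unfolding sub monics_def by blast
    qed
  qed (auto simp: fun_eq_iff)
  from bij_betw_same_card[OF this] show ?thesis by simp
qed

text \<open>
  For a monic polynomial of degree \<open>d\<close> the vector \<open>u\<^sub>n\<^sub>+\<^sub>d\<^sub>+\<^sub>1\<close> enters the coefficient of \<open>t\<close> to the power
  \<open>-(n + 1)\<close> with factor 1, so that the condition can be solved for it.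
\<close>

lemma next_coeffs_monic_eq_0_iff:
  assumes "\<theta> d = 1"
  shows "next_coeffs r u n (Suc d) \<theta> = (\<lambda>_. 0) \<longleftrightarrow>
    coeff_column r (Suc (n + d)) u = (\<lambda>i. - next_coeffs r u n d \<theta> i)"
  using assms by (auto simp: next_coeffs_def coeff_column_def fun_eq_iff eq_neg_iff_add_eq_0 add.commute)

lemma monics_Suc:
  "monics r u (Suc n) d =
    {\<theta>\<in>monics r u n d. coeff_column r (Suc (n + d)) u = (\<lambda>i. - next_coeffs r u n d \<theta> i)}"
  unfolding monics_def Ker_Suc using next_coeffs_monic_eq_0_iff by blast

text \<open>
  The values of \<open>u\<^sub>n\<^sub>+\<^sub>d\<^sub>+\<^sub>1\<close> for which some monic kernel element of degree \<open>d\<close> for \<open>n\<close> stays in the kernel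
  for \<open>n + 1\<close>.
\<close>

definition hitting_columns :: "nat \<Rightarrow> (nat \<Rightarrow> nat \<Rightarrow> 'a::{field,finite}) \<Rightarrow> nat \<Rightarrow> nat \<Rightarrow> (nat \<Rightarrow> 'a) set" where
  "hitting_columns r u n d = (\<lambda>\<theta> i. - next_coeffs r u n d \<theta> i) ` monics r u n d"

lemma epoch_survives_iff:
  "d \<in> epochs r u (Suc n) \<longleftrightarrow> coeff_column r (Suc (n + d)) u \<in> hitting_columns r u n d"
  unfolding mem_epochs_iff monics_Suc hitting_columns_def by auto

lemma hitting_columns_subset: "hitting_columns r u n d \<subseteq> columns r"
  by (auto simp: hitting_columns_def columns_def next_coeffs_def)

lemma known_hitting_columns: "known r (n + d) (\<lambda>u :: nat \<Rightarrow> nat \<Rightarrow> 'a::{field,finite}. hitting_columns r u n d)"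
  unfolding known_def hitting_columns_def monics_def
  by (simp add: knownD[OF known_Ker[of n "Suc d" "n + d" r]] knownD[OF known_next_coeffs[of n d "n + d" r]])

text \<open>
  Two monic kernel elements of degree \<open>d\<close> that require the same column differ by an element of degree
  less than \<open>d\<close> of the kernel for \<open>n + 1\<close>, which is trivial by assumption.
\<close>

lemma card_hitting_columns:
  fixes u :: "nat \<Rightarrow> nat \<Rightarrow> 'a::{field,finite}"
  assumes d: "d \<in> epochs r u n" and none: "epochs r u (Suc n) \<inter> {..<d} = {}"
  shows "card (hitting_columns r u n d) = CARD('a) ^ card (epochs r u n \<inter> {..<d})"
proof -
  have zero: "Ker r u (Suc n) d = {\<lambda>_. 0}"
    using card_Ker[of r u "Suc n" d] none Ker_zero[of r u "Suc n" d]
    by (auto simp: card_1_singleton_iff)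
  have "inj_on (\<lambda>\<theta> i. - next_coeffs r u n d \<theta> i) (monics r u n d)"
  proof (rule inj_onI)
    fix \<theta> \<eta> assume \<theta>: "\<theta> \<in> monics r u n d" and \<eta>: "\<eta> \<in> monics r u n d"
      and eq: "(\<lambda>i. - next_coeffs r u n d \<theta> i) = (\<lambda>i. - next_coeffs r u n d \<eta> i)"
    \<comment> \<open>The leading terms cancel in the difference of two monic polynomials.\<close>
    let ?\<delta> = "\<lambda>k. (-1) * \<theta> k + \<eta> k"
    have "?\<delta> k = 0" if "k \<ge> d" for k
      using that \<theta> \<eta> by (cases "k = d") (auto simp: monics_def Ker_def)
    moreover have "?\<delta> \<in> Ker r u n (Suc d)"
      using Ker_lincomb[of \<theta> r u n "Suc d" \<eta> "-1"] \<theta> \<eta> by (simp add: monics_def)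
    ultimately have "?\<delta> \<in> Ker r u n d"
      using Ker_restrict_degree[of d "Suc d" r u n] by simp
    moreover have "next_coeffs r u n d ?\<delta> = (\<lambda>_. 0)"
      unfolding next_coeffs_lincomb using eq by (simp add: fun_eq_iff)
    ultimately have "?\<delta> = (\<lambda>_. 0)"
      using zero unfolding Ker_Suc by blast
    then show "\<theta> = \<eta>" by (auto simp: fun_eq_iff)
  qed
  then show ?thesis
    unfolding hitting_columns_def by (simp add: card_image card_monics[OF d] card_Ker)
qed

text \<open>
  A truncation to \<open>N + 1\<close> vectors is a truncation to \<open>N\<close> vectors together with an arbitrary last column.
\<close>

lemma card_known_times_column:
  fixes V :: "(nat \<Rightarrow> nat \<Rightarrow> 'a::{field,finite}) \<Rightarrow> (nat \<Rightarrow> 'a) set"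
  assumes \<Phi>: "known r N \<Phi>" and V: "known r N V"
    and sub: "\<And>u. \<Phi> u \<Longrightarrow> V u \<subseteq> columns r"
    and card: "\<And>u. \<Phi> u \<Longrightarrow> card (V u) = v"
  shows "card {c \<in> range (trunc r (Suc N)). \<Phi> c \<and> coeff_column r (Suc N) c \<in> V c} =
    card {c \<in> range (trunc r N). \<Phi> c} * v"
proof -
  let ?A = "{c \<in> range (trunc r (Suc N)). \<Phi> c \<and> coeff_column r (Suc N) c \<in> V c}"
  let ?B = "{c \<in> range (trunc r N). \<Phi> c}"
  let ?g = "\<lambda>(c, w) i j. if j = Suc N then w i else c i j"
  have fixed: "trunc r k c = c" if "c \<in> range (trunc r k)" for c :: "nat \<Rightarrow> nat \<Rightarrow> 'a" and k
    using that by (auto simp: trunc_trunc)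
  have g: "trunc r (Suc N) (?g (c, w)) = ?g (c, w)" "trunc r N (?g (c, w)) = c"
    "coeff_column r (Suc N) (?g (c, w)) = w"
    if c: "c \<in> range (trunc r N)" and w: "w \<in> columns r" for c w
  proof -
    have c0: "c i j = 0" if "i \<notin> {1..r} \<or> j \<notin> {1..N}" for i j
      using c that by (auto simp: trunc_def)
    have w0: "w i = 0" if "i \<notin> {1..r}" for i
      using w that by (auto simp: columns_def)
    show "trunc r (Suc N) (?g (c, w)) = ?g (c, w)" "trunc r N (?g (c, w)) = c"
      "coeff_column r (Suc N) (?g (c, w)) = w"
      unfolding trunc_def coeff_column_def by (intro ext; use c0 w0 in force)+
  qed
  have "bij_betw (\<lambda>c. (trunc r N c, coeff_column r (Suc N) c)) ?A (Sigma ?B V)"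
  proof (rule bij_betw_byWitness[where f' = ?g])
    show "\<forall>c\<in>?A. ?g (trunc r N c, coeff_column r (Suc N) c) = c"
    proof
      fix c assume "c \<in> ?A"
      then have c: "trunc r (Suc N) c = c" using fixed by blast
      have "?g (trunc r N c, coeff_column r (Suc N) c) = trunc r (Suc N) c"
        by (auto simp: trunc_def coeff_column_def fun_eq_iff)
      with c show "?g (trunc r N c, coeff_column r (Suc N) c) = c" by simp
    qed
    show "\<forall>p\<in>Sigma ?B V. (trunc r N (?g p), coeff_column r (Suc N) (?g p)) = p"
    proof
      fix p assume "p \<in> Sigma ?B V"
      then obtain c w where p: "p = (c, w)" "c \<in> range (trunc r N)" "\<Phi> c" "w \<in> V c" by blast
      with sub have "w \<in> columns r" by blast
      from g(2,3)[OF p(2) this] p(1) show "(trunc r N (?g p), coeff_column r (Suc N) (?g p)) = p" by simp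
    qed
    show "(\<lambda>c. (trunc r N c, coeff_column r (Suc N) c)) ` ?A \<subseteq> Sigma ?B V"
    proof (rule image_subsetI)
      fix c assume "c \<in> ?A"
      then show "(trunc r N c, coeff_column r (Suc N) c) \<in> Sigma ?B V"
        using knownD[OF \<Phi>, of c] knownD[OF V, of c] by simp
    qed
    show "?g ` Sigma ?B V \<subseteq> ?A"
    proof (rule image_subsetI)
      fix p assume "p \<in> Sigma ?B V"
      then obtain c w where p: "p = (c, w)" "c \<in> range (trunc r N)" "\<Phi> c" "w \<in> V c" by blast
      with sub have wc: "w \<in> columns r" by blast
      have gp: "trunc r (Suc N) (?g p) = ?g p" "trunc r N (?g p) = c" "coeff_column r (Suc N) (?g p) = w"
        using g[OF p(2) wc] p(1) by simp_all
      have "\<Phi> (?g p)" "coeff_column r (Suc N) (?g p) \<in> V (?g p)"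
        using knownD[OF \<Phi>, of "?g p"] knownD[OF V, of "?g p"] p(3,4) unfolding gp by simp_all
      moreover have "?g p \<in> range (trunc r (Suc N))"
        by (subst gp(1)[symmetric]) (rule rangeI)
      ultimately show "?g p \<in> ?A" by blast
    qed
  qed
  then have "card ?A = card (Sigma ?B V)" by (rule bij_betw_same_card)
  also have "\<dots> = (\<Sum>c\<in>?B. card (V c))"
  proof (rule card_SigmaI)
    show "finite ?B" by (rule finite_subset[OF _ finite_range_trunc[of r N]]) blast
    show "\<forall>c\<in>?B. finite (V c)" using sub finite_columns by (blast intro: finite_subset)
  qed
  also have "\<dots> = card ?B * v" using card by simp
  finally show ?thesis .
qed

lemma known_event_eq:
  assumes "known r N \<Phi>"
  shows "{\<omega>\<in>S. \<Phi> (U \<omega>)} =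
    (\<Union>c\<in>{c \<in> range (trunc r N). \<Phi> c}. {\<omega>\<in>S. trunc r N (U \<omega>) = c})"
proof (intro equalityI subsetI)
  fix \<omega> assume \<omega>: "\<omega> \<in> {\<omega>\<in>S. \<Phi> (U \<omega>)}"
  show "\<omega> \<in> (\<Union>c\<in>{c \<in> range (trunc r N). \<Phi> c}. {\<omega>\<in>S. trunc r N (U \<omega>) = c})"
    by (rule UN_I[of "trunc r N (U \<omega>)"]) (use \<omega> in \<open>simp_all add: knownD[OF assms]\<close>)
next
  fix \<omega> assume "\<omega> \<in> (\<Union>c\<in>{c \<in> range (trunc r N). \<Phi> c}. {\<omega>\<in>S. trunc r N (U \<omega>) = c})"
  then obtain c where "\<Phi> c" "\<omega> \<in> S" "trunc r N (U \<omega>) = c"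
    unfolding UN_iff mem_Collect_eq by (elim bexE conjE CollectE)
  then have "\<omega> \<in> S" "\<Phi> (trunc r N (U \<omega>))" by simp_all
  then show "\<omega> \<in> {\<omega>\<in>S. \<Phi> (U \<omega>)}" by (simp add: knownD[OF assms])
qed

section \<open>Survival probabilities for uniform coefficients\<close>

lemma sets_Collect_mem:
  assumes "A \<in> sets M" "{x\<in>space M. P x} \<in> sets M"
  shows "{x\<in>A. P x} \<in> sets M"
proof -
  have "{x\<in>A. P x} = A \<inter> {x\<in>space M. P x}"
    using sets.sets_into_space[OF assms(1)] by auto
  with assms show ?thesis by simp
qed

text \<open>
  The assumption on the cylinders says that the coefficients \<open>u\<^sub>i\<^sub>,\<^sub>j\<close> with \<open>1 \<le> i \<le> r\<close> and \<open>j \<ge> 1\<close> are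
  iid uniform on the field. All probabilities needed below are finite counts derived from it.
\<close>

locale uniform_coefficients = prob_space M for M :: "'w measure" +
  fixes U :: "'w \<Rightarrow> nat \<Rightarrow> nat \<Rightarrow> 'a::{field,finite}" and r :: nat
  assumes cylinder_sets: "{\<omega>\<in>space M. trunc r N (U \<omega>) = c} \<in> sets M"
    and prob_cylinder: "c \<in> range (trunc r N) \<Longrightarrow>
      prob {\<omega>\<in>space M. trunc r N (U \<omega>) = c} = 1 / real CARD('a) ^ (r * N)"
begin

lemma known_event:
  assumes "known r N \<Phi>"
  shows "{\<omega>\<in>space M. \<Phi> (U \<omega>)} \<in> sets M"
  unfolding known_event_eq[OF assms, of "space M" U]
proof (rule sets.finite_UN)
  show "finite {c \<in> range (trunc r N). \<Phi> c}" 
    by (rule finite_subset[OF _ finite_range_trunc[of r N]]) blast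
qed (rule cylinder_sets)

lemma prob_known:
  assumes "known r N \<Phi>"
  shows "prob {\<omega>\<in>space M. \<Phi> (U \<omega>)} = real (card {c \<in> range (trunc r N). \<Phi> c}) / real CARD('a) ^ (r * N)"
proof -
  let ?B = "{c \<in> range (trunc r N). \<Phi> c}"
  have "prob {\<omega>\<in>space M. \<Phi> (U \<omega>)} = (\<Sum>c\<in>?B. prob {\<omega>\<in>space M. trunc r N (U \<omega>) = c})"
    unfolding known_event_eq[OF assms, of "space M" U]
  proof (rule finite_measure_finite_Union)
    show "finite ?B" by (rule finite_subset[OF _ finite_range_trunc[of r N]]) blast
  qed (auto simp: disjoint_family_on_def intro: cylinder_sets)
  also have "\<dots> = (\<Sum>c\<in>?B. 1 / real CARD('a) ^ (r * N))"
    by (intro sum.cong prob_cylinder) auto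
  finally show ?thesis by simp
qed

text \<open>
  The vector \<open>u\<^sub>N\<^sub>+\<^sub>1\<close> is uniform and independent of the first \<open>N\<close> vectors, hence it lies in a set of
  \<open>v\<close> vectors that is chosen by looking at the past with probability \<open>v / q\<^sup>r\<close>.
\<close>

lemma prob_fresh_column:
  fixes V :: "(nat \<Rightarrow> nat \<Rightarrow> 'a) \<Rightarrow> (nat \<Rightarrow> 'a) set"
  assumes \<Phi>: "known r N \<Phi>" and V: "known r N V"
    and sub: "\<And>u. \<Phi> u \<Longrightarrow> V u \<subseteq> columns r"
    and card: "\<And>u. \<Phi> u \<Longrightarrow> card (V u) = v"
  shows "prob {\<omega>\<in>space M. \<Phi> (U \<omega>) \<and> coeff_column r (Suc N) (U \<omega>) \<in> V (U \<omega>)} =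
    prob {\<omega>\<in>space M. \<Phi> (U \<omega>)} * (real v / real CARD('a) ^ r)"
proof -
  have "known r (Suc N) (coeff_column r (Suc N) :: (nat \<Rightarrow> nat \<Rightarrow> 'a) \<Rightarrow> _)"
    by (auto simp: known_def coeff_column_def trunc_def fun_eq_iff)
  with known_mono[OF \<Phi>, of "Suc N"] known_mono[OF V, of "Suc N"]
  have "known r (Suc N) (\<lambda>u. \<Phi> u \<and> coeff_column r (Suc N) u \<in> V u)"
    by (simp add: known_def)
  from prob_known[OF this] show ?thesis
    using card_known_times_column[OF \<Phi> V sub card] prob_known[OF \<Phi>]
    by (simp add: power_add)
qed

lemma prob_epoch_survives:
  assumes \<Phi>: "known r (n + d) \<Phi>"
    and epoch: "\<And>u. \<Phi> u \<Longrightarrow> epoch_degree r u n j = d"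
    and none: "\<And>u. \<Phi> u \<Longrightarrow> d \<le> epoch_degree r u (Suc n) 0"
  shows "prob {\<omega>\<in>space M. \<Phi> (U \<omega>) \<and> epoch_degree r (U \<omega>) (Suc n) 0 = d} =
    prob {\<omega>\<in>space M. \<Phi> (U \<omega>)} * (real CARD('a) ^ j / real CARD('a) ^ r)"
proof -
  have none': "epochs r u (Suc n) \<inter> {..<d} = {}" if "\<Phi> u" for u
    using none[OF that] epoch_degree_0_less_iff[of r u "Suc n" d] by auto
  have "epoch_degree r u (Suc n) 0 = d \<longleftrightarrow> coeff_column r (Suc (n + d)) u \<in> hitting_columns r u n d"
    if "\<Phi> u" for u
    using none'[OF that] by (simp add: epoch_degree_eq_iff epoch_survives_iff)
  then have "{\<omega>\<in>space M. \<Phi> (U \<omega>) \<and> epoch_degree r (U \<omega>) (Suc n) 0 = d} =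
      {\<omega>\<in>space M. \<Phi> (U \<omega>) \<and> coeff_column r (Suc (n + d)) (U \<omega>) \<in> hitting_columns r (U \<omega>) n d}"
    by blast
  also have "prob \<dots> = prob {\<omega>\<in>space M. \<Phi> (U \<omega>)} * (real (CARD('a) ^ j) / real CARD('a) ^ r)"
  proof (rule prob_fresh_column[OF \<Phi> known_hitting_columns hitting_columns_subset])
    fix u assume "\<Phi> u"
    then have "d \<in> epochs r u n" "card (epochs r u n \<inter> {..<d}) = j"
      using epoch epoch_degree_eq_iff by blast+
    then show "card (hitting_columns r u n d) = CARD('a) ^ j"
      using card_hitting_columns none'[OF \<open>\<Phi> u\<close>] by metis
  qed
  finally show ?thesis by simp
qed

lemma measurable_epoch_degree [measurable]:
  "(\<lambda>\<omega>. epoch_degree r (U \<omega>) n j) \<in> M \<rightarrow>\<^sub>M count_space UNIV"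
proof (rule measurable_count_space_eq2_countable[THEN iffD2], intro conjI ballI)
  fix d
  have "{\<omega>\<in>space M. epoch_degree r (U \<omega>) n j = d} \<in> sets M"
    by (rule known_event[OF known_epoch_degree_eq[OF order.refl]])
  then show "(\<lambda>\<omega>. epoch_degree r (U \<omega>) n j) -` {d} \<inter> space M \<in> sets M"
    by (simp add: vimage_def Int_def conj_commute)
qed auto

lemma sets_survival:
  "{\<omega>\<in>space M. epoch_degree r (U \<omega>) n i \<le> epoch_degree r (U \<omega>) m j} \<in> sets M"
  "{\<omega>\<in>space M. epoch_degree r (U \<omega>) n i = epoch_degree r (U \<omega>) m j} \<in> sets M"
proof -
  have [measurable]: "(\<lambda>\<omega>. epoch_degree r (U \<omega>) n j) \<in> borel_measurable M" for n j
    by (rule measurable_compose[OF measurable_epoch_degree]) simp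
  show "{\<omega>\<in>space M. epoch_degree r (U \<omega>) n i \<le> epoch_degree r (U \<omega>) m j} \<in> sets M"
    "{\<omega>\<in>space M. epoch_degree r (U \<omega>) n i = epoch_degree r (U \<omega>) m j} \<in> sets M"
    by (rule borel_measurable_le borel_measurable_eq; measurable)+
qed

text \<open>
  The assumption says that \<open>A\<close> belongs to the sigma-algebra stopped at \<open>n + \<sigma>\<^sub>j\<close>, where \<open>\<sigma>\<^sub>j\<close> is the degree of
  the epoch with index \<open>j\<close>. Since \<open>\<sigma>\<^sub>j \<le> r n + j\<close>, it suffices to apply \<open>prob_epoch_survives\<close> to each value
  of \<open>\<sigma>\<^sub>j\<close> and to sum over finitely many values.
\<close>

lemma prob_first_survival_at:
  assumes A: "A \<in> sets M"
    and known: "\<And>d. \<exists>\<Phi>. known r (n + d) \<Phi> \<and>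
      (\<forall>\<omega>\<in>space M. \<Phi> (U \<omega>) \<longleftrightarrow> \<omega> \<in> A \<and> epoch_degree r (U \<omega>) n j = d)"
  shows "prob {\<omega>\<in>A. epoch_degree r (U \<omega>) (Suc n) 0 = epoch_degree r (U \<omega>) n j} =
    prob {\<omega>\<in>A. epoch_degree r (U \<omega>) n j \<le> epoch_degree r (U \<omega>) (Suc n) 0} *
      (real CARD('a) ^ j / real CARD('a) ^ r)"
proof -
  obtain \<Phi> where \<Phi>: "known r (n + d) (\<Phi> d)"
    "\<And>\<omega>. \<omega> \<in> space M \<Longrightarrow> \<Phi> d (U \<omega>) \<longleftrightarrow> \<omega> \<in> A \<and> epoch_degree r (U \<omega>) n j = d" for d
    using known by metis
  \<comment> \<open>\<open>\<Phi> d u\<close> gives the second conjunct only for \<open>u\<close> in the image of \<open>U\<close>; with it, \<open>\<Psi> d\<close> fixes the degree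
    of the epoch for every coefficient array.\<close>
  define \<Psi> where "\<Psi> d u \<longleftrightarrow> \<Phi> d u \<and> epoch_degree r u n j = d \<and> d \<le> epoch_degree r u (Suc n) 0" for d u
  have known_\<Psi>: "known r (n + d) (\<Psi> d)" for d
    using \<Phi>(1)[of d] known_epoch_degree_eq[of n d "n + d" r j, where 'a='a]
      known_first_epoch_less[of "Suc n" d "n + d" r, where 'a='a]
    unfolding known_def \<Psi>_def not_less[symmetric] by simp
  note AM = sets.sets_into_space[OF A]
  have \<Psi>_iff: "\<Psi> d (U \<omega>) \<longleftrightarrow> \<omega> \<in> A \<and> epoch_degree r (U \<omega>) n j = d \<and> d \<le> epoch_degree r (U \<omega>) (Suc n) 0"
    if "\<omega> \<in> space M" for d \<omega>
    using \<Phi>(2)[OF that] by (auto simp: \<Psi>_def)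
  let ?H = "\<lambda>d. {\<omega>\<in>space M. \<Psi> d (U \<omega>) \<and> epoch_degree r (U \<omega>) (Suc n) 0 = d}"
  let ?N = "\<lambda>d. {\<omega>\<in>space M. \<Psi> d (U \<omega>)}"
  have N_sets: "?N d \<in> sets M" for d by (rule known_event[OF known_\<Psi>])
  then have H_sets: "?H d \<in> sets M" for d by measurable
  have "{\<omega>\<in>A. epoch_degree r (U \<omega>) (Suc n) 0 = epoch_degree r (U \<omega>) n j} = (\<Union>d\<in>{..r * n + j}. ?H d)"
    using \<Psi>_iff AM epoch_degree_le by (auto simp: subset_eq)
  then have "prob {\<omega>\<in>A. epoch_degree r (U \<omega>) (Suc n) 0 = epoch_degree r (U \<omega>) n j} =
      (\<Sum>d\<in>{..r * n + j}. prob (?H d))"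
    using H_sets by (simp only:) (intro finite_measure_finite_Union, auto simp: disjoint_family_on_def)
  also have "\<dots> = (\<Sum>d\<in>{..r * n + j}. prob (?N d) * (real CARD('a) ^ j / real CARD('a) ^ r))"
    by (intro sum.cong refl prob_epoch_survives[OF known_\<Psi>]) (auto simp: \<Psi>_def)
  also have "\<dots> = (\<Sum>d\<in>{..r * n + j}. prob (?N d)) * (real CARD('a) ^ j / real CARD('a) ^ r)"
    by (rule sum_distrib_right[symmetric])
  also have "(\<Sum>d\<in>{..r * n + j}. prob (?N d)) = prob (\<Union>d\<in>{..r * n + j}. ?N d)"
    using N_sets by (intro finite_measure_finite_Union[symmetric]) (auto simp: disjoint_family_on_def \<Psi>_def)
  also have "(\<Union>d\<in>{..r * n + j}. ?N d) =
      {\<omega>\<in>A. epoch_degree r (U \<omega>) n j \<le> epoch_degree r (U \<omega>) (Suc n) 0}"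
    using \<Psi>_iff AM epoch_degree_le by (auto simp: subset_eq)
  finally show ?thesis .
qed

text \<open>
  Here \<open>A\<close> belongs to the sigma-algebra stopped at \<open>n + \<sigma>\<^sub>0 + 1\<close>. Because \<open>\<sigma>\<^sub>0 + 1 \<le> \<sigma>\<^sub>j\<close> for \<open>j \<ge> 1\<close>, 
  \<open>prob_first_survival_at\<close> applies to each of \<open>\<sigma>\<^sub>1, \<sigma>\<^sub>2, \<dots>\<close>, and each of them that does not survive contributes one
  factor to the product.
\<close>

lemma prob_no_survival_before:
  assumes A: "A \<in> sets M"
    and known: "\<And>d. \<exists>\<Phi>. known r (n + d) \<Phi> \<and>
      (\<forall>\<omega>\<in>space M. \<Phi> (U \<omega>) \<longleftrightarrow> \<omega> \<in> A \<and> epoch_degree r (U \<omega>) n 0 < d)"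
    and "j \<ge> 1"
  shows "prob {\<omega>\<in>A. epoch_degree r (U \<omega>) n j \<le> epoch_degree r (U \<omega>) (Suc n) 0} =
      prob {\<omega>\<in>A. epoch_degree r (U \<omega>) n 1 \<le> epoch_degree r (U \<omega>) (Suc n) 0} *
      (\<Prod>a\<in>{1..<j}. 1 - real CARD('a) ^ a / real CARD('a) ^ r)"
    and "prob {\<omega>\<in>A. epoch_degree r (U \<omega>) (Suc n) 0 = epoch_degree r (U \<omega>) n j} =
      prob {\<omega>\<in>A. epoch_degree r (U \<omega>) n j \<le> epoch_degree r (U \<omega>) (Suc n) 0} *
      (real CARD('a) ^ j / real CARD('a) ^ r)"
proof -
  have hit: "prob {\<omega>\<in>A. epoch_degree r (U \<omega>) (Suc n) 0 = epoch_degree r (U \<omega>) n j} =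
      prob {\<omega>\<in>A. epoch_degree r (U \<omega>) n j \<le> epoch_degree r (U \<omega>) (Suc n) 0} *
      (real CARD('a) ^ j / real CARD('a) ^ r)" if "j \<ge> 1" for j
  proof (rule prob_first_survival_at[OF A])
    fix d
    obtain \<Phi> where \<Phi>: "known r (n + d) \<Phi>"
      "\<And>\<omega>. \<omega> \<in> space M \<Longrightarrow> \<Phi> (U \<omega>) \<longleftrightarrow> \<omega> \<in> A \<and> epoch_degree r (U \<omega>) n 0 < d"
      using known[of d] by metis
    have "known r (n + d) (\<lambda>u. \<Phi> u \<and> epoch_degree r u n j = d)"
      using \<Phi>(1) known_epoch_degree_eq[of n d "n + d" r j, where 'a='a]
      by (simp add: known_def)
    moreover have "epoch_degree r u n 0 < d" if "epoch_degree r u n j = d" for u :: "nat \<Rightarrow> nat \<Rightarrow> 'a"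
      using that \<open>j \<ge> 1\<close> enumerate_mono_iff[OF infinite_epochs, of r u n 0 j] by simp
    ultimately show "\<exists>\<Phi>. known r (n + d) \<Phi> \<and>
        (\<forall>\<omega>\<in>space M. \<Phi> (U \<omega>) \<longleftrightarrow> \<omega> \<in> A \<and> epoch_degree r (U \<omega>) n j = d)"
      using \<Phi>(2) by (intro exI[of _ "\<lambda>u. \<Phi> u \<and> epoch_degree r u n j = d"]) auto
  qed
  then show "prob {\<omega>\<in>A. epoch_degree r (U \<omega>) (Suc n) 0 = epoch_degree r (U \<omega>) n j} =
      prob {\<omega>\<in>A. epoch_degree r (U \<omega>) n j \<le> epoch_degree r (U \<omega>) (Suc n) 0} *
      (real CARD('a) ^ j / real CARD('a) ^ r)"
    using \<open>j \<ge> 1\<close> .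
  show "prob {\<omega>\<in>A. epoch_degree r (U \<omega>) n j \<le> epoch_degree r (U \<omega>) (Suc n) 0} =
      prob {\<omega>\<in>A. epoch_degree r (U \<omega>) n 1 \<le> epoch_degree r (U \<omega>) (Suc n) 0} *
      (\<Prod>a\<in>{1..<j}. 1 - real CARD('a) ^ a / real CARD('a) ^ r)"
    using \<open>j \<ge> 1\<close>
  proof (induction j rule: dec_induct)
    case base
    then show ?case by simp
  next
    case (step j)
    let ?N = "\<lambda>j. {\<omega>\<in>A. epoch_degree r (U \<omega>) n j \<le> epoch_degree r (U \<omega>) (Suc n) 0}"
    let ?H = "{\<omega>\<in>A. epoch_degree r (U \<omega>) (Suc n) 0 = epoch_degree r (U \<omega>) n j}"
    have "epoch_degree r u n (Suc j) \<le> epoch_degree r u (Suc n) 0 \<longleftrightarrow>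
        epoch_degree r u n j \<le> epoch_degree r u (Suc n) 0 \<and>
        epoch_degree r u (Suc n) 0 \<noteq> epoch_degree r u n j" for u :: "nat \<Rightarrow> nat \<Rightarrow> 'a"
    proof -
      obtain i where "epoch_degree r u (Suc n) 0 = epoch_degree r u n i"
        using first_epoch_Suc by blast
      then show ?thesis
        by (simp add: enumerate_mono_le_iff[OF infinite_epochs] epoch_degree_inject) linarith
    qed
    then have "?N (Suc j) = ?N j - ?H" by blast
    moreover have "?N j \<in> sets M" "?H \<in> sets M"
      by (rule sets_Collect_mem[OF A sets_survival(1)] sets_Collect_mem[OF A sets_survival(2)])+
    ultimately have "prob (?N (Suc j)) = prob (?N j) - prob ?H"
      by (simp add: finite_measure_Diff subset_eq)
    also have "\<dots> = prob (?N j) * (1 - real CARD('a) ^ j / real CARD('a) ^ r)"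
      using hit[OF \<open>1 \<le> j\<close>] by (simp add: algebra_simps)
    finally show ?case
      using step by (simp add: prod.atLeastLessThan_Suc)
  qed
qed

text \<open>
  Each step from \<open>n\<close> to \<open>n + 1\<close> prescribes the value of one fresh coefficient vector.
\<close>

lemma prob_monic_in_Ker:
  assumes top: "\<theta> d = 1" and supp: "\<forall>k>d. \<theta> k = 0"
  shows "prob {\<omega>\<in>space M. \<theta> \<in> Ker r (U \<omega>) n (Suc d)} = 1 / real CARD('a) ^ (r * n)"
proof (induction n)
  case 0
  have "\<theta> \<in> Ker r (U \<omega>) 0 (Suc d)" for \<omega>
    using supp by (auto simp: Ker_def)
  then show ?case by (simp add: prob_space)
next
  case (Suc n)
  let ?V = "\<lambda>u. {\<lambda>i. - next_coeffs r u n d \<theta> i}"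
  have "known r (n + d) (\<lambda>u :: nat \<Rightarrow> nat \<Rightarrow> 'a. \<theta> \<in> Ker r u n (Suc d))"
    using known_Ker[of n "Suc d" "n + d" r, where 'a='a] by (simp add: known_def)
  moreover have "known r (n + d) ?V"
    using known_next_coeffs[of n d "n + d" r, where 'a='a] by (simp add: known_def)
  moreover have "?V u \<subseteq> columns r" for u :: "nat \<Rightarrow> nat \<Rightarrow> 'a"
    by (auto simp: columns_def next_coeffs_def)
  ultimately have "prob {\<omega>\<in>space M. \<theta> \<in> Ker r (U \<omega>) n (Suc d) \<and> coeff_column r (Suc (n + d)) (U \<omega>) \<in> ?V (U \<omega>)} =
      prob {\<omega>\<in>space M. \<theta> \<in> Ker r (U \<omega>) n (Suc d)} * (real 1 / real CARD('a) ^ r)"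
    by (intro prob_fresh_column) auto
  moreover have "\<theta> \<in> Ker r u (Suc n) (Suc d) \<longleftrightarrow>
      \<theta> \<in> Ker r u n (Suc d) \<and> coeff_column r (Suc (n + d)) u \<in> ?V u" for u :: "nat \<Rightarrow> nat \<Rightarrow> 'a"
    unfolding Ker_Suc by (simp add: next_coeffs_monic_eq_0_iff[of \<theta> d, OF top])
  ultimately show ?case
    using Suc by (simp add: power_add)
qed

lemma prob_epoch_le: "prob {\<omega>\<in>space M. d \<in> epochs r (U \<omega>) n} \<le> real CARD('a) ^ d / real CARD('a) ^ (r * n)"
proof -
  let ?\<Theta> = "{\<theta> :: nat \<Rightarrow> 'a. \<theta> d = 1 \<and> (\<forall>k>d. \<theta> k = 0)}"
  let ?F = "{\<theta> :: nat \<Rightarrow> 'a. \<forall>k. k \<notin> {..<d} \<longrightarrow> \<theta> k = 0}"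
  have inj: "inj_on (\<lambda>\<theta>. \<theta>(d := 0)) ?\<Theta>"
  proof (rule inj_onI)
    fix \<theta> \<eta> assume "\<theta> \<in> ?\<Theta>" "\<eta> \<in> ?\<Theta>" "\<theta>(d := 0) = \<eta>(d := 0)"
    then show "\<theta> = \<eta>" by (metis (mono_tags, lifting) fun_upd_triv fun_upd_upd mem_Collect_eq)
  qed
  have sub: "(\<lambda>\<theta>. \<theta>(d := 0)) ` ?\<Theta> \<subseteq> ?F" by auto
  have fin: "finite ?\<Theta>"
    by (rule inj_on_finite[OF inj sub finite_supported_functions]) simp
  have "card ?\<Theta> \<le> card ?F"
    by (rule card_inj_on_le[OF inj sub finite_supported_functions]) simp
  also have "card ?F = CARD('a) ^ d"
    by (subst card_supported_functions) auto
  finally have card: "card ?\<Theta> \<le> CARD('a) ^ d" .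
  have ev: "{\<omega>\<in>space M. \<theta> \<in> Ker r (U \<omega>) n (Suc d)} \<in> sets M" for \<theta>
    using known_Ker[of n "Suc d" "n + d" r, where 'a='a]
    by (intro known_event[of "n + d"]) (simp add: known_def)
  have "{\<omega>\<in>space M. d \<in> epochs r (U \<omega>) n} = (\<Union>\<theta>\<in>?\<Theta>. {\<omega>\<in>space M. \<theta> \<in> Ker r (U \<omega>) n (Suc d)})"
  proof -
    have "\<theta> \<in> ?\<Theta>" if "\<theta> \<in> Ker r u n (Suc d)" "\<theta> d = 1" for \<theta> u
      using that by (auto simp: Ker_def)
    then show ?thesis unfolding epochs_def by blast
  qed
  also have "prob \<dots> \<le> (\<Sum>\<theta>\<in>?\<Theta>. prob {\<omega>\<in>space M. \<theta> \<in> Ker r (U \<omega>) n (Suc d)})"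
    using ev by (intro finite_measure_subadditive_finite fin) auto
  also have "\<dots> = (\<Sum>\<theta>\<in>?\<Theta>. 1 / real CARD('a) ^ (r * n))"
    by (intro sum.cong prob_monic_in_Ker) auto
  also have "\<dots> = real (card ?\<Theta>) / real CARD('a) ^ (r * n)"
    by simp
  also have "\<dots> \<le> real (CARD('a) ^ d) / real CARD('a) ^ (r * n)"
    using card by (intro divide_right_mono) (auto simp only: of_nat_le_iff, simp)
  finally show ?thesis by simp
qed

lemma prob_first_epoch_less_le:
  "prob {\<omega>\<in>space M. epoch_degree r (U \<omega>) n 0 < d} \<le>
    (real CARD('a) ^ d - 1) / ((real CARD('a) - 1) * real CARD('a) ^ (r * n))"
proof -
  have q: "real CARD('a) \<noteq> 1" using CARD_field_ge_2[where 'a='a] by simp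
  have "{\<omega>\<in>space M. epoch_degree r (U \<omega>) n 0 < d} = (\<Union>m\<in>{..<d}. {\<omega>\<in>space M. m \<in> epochs r (U \<omega>) n})"
    unfolding epoch_degree_0_less_iff by auto
  also have "prob \<dots> \<le> (\<Sum>m\<in>{..<d}. prob {\<omega>\<in>space M. m \<in> epochs r (U \<omega>) n})"
  proof (intro finite_measure_subadditive_finite image_subsetI)
    fix m
    show "{\<omega>\<in>space M. m \<in> epochs r (U \<omega>) n} \<in> sets M"
    proof (rule known_event[of "n + m"])
      have "known r (n + m) (\<lambda>u :: nat \<Rightarrow> nat \<Rightarrow> 'a. m \<in> epochs r u n \<inter> {..<Suc m})"
        by (rule known_comp[of r "n + m" "\<lambda>u. epochs r u n \<inter> {..<Suc m}" "\<lambda>S. m \<in> S"], rule known_epochs_below) simp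
      then show "known r (n + m) (\<lambda>u :: nat \<Rightarrow> nat \<Rightarrow> 'a. m \<in> epochs r u n)" by simp
    qed
  qed simp
  also have "\<dots> \<le> (\<Sum>m\<in>{..<d}. real CARD('a) ^ m / real CARD('a) ^ (r * n))"
    by (intro sum_mono prob_epoch_le)
  also have "\<dots> = (\<Sum>m\<in>{..<d}. real CARD('a) ^ m) / real CARD('a) ^ (r * n)"
    by (simp add: sum_divide_distrib)
  also have "\<dots> = (real CARD('a) ^ d - 1) / ((real CARD('a) - 1) * real CARD('a) ^ (r * n))"
    using geometric_sum[OF q, of d] by simp
  finally show ?thesis .
qed

text \<open>
  A jump means that \<open>\<sigma>\<^sub>0\<close> does not survive, which has conditional probability \<open>1 - q\<^bsup>-r\<^esup>\<close> whatever the value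
  of \<open>\<sigma>\<^sub>0\<close>.
\<close>

lemma prob_jump_and_first_epoch_less:
  "prob {\<omega>\<in>space M. epoch_degree r (U \<omega>) n 0 < d \<and>
      epoch_degree r (U \<omega>) (Suc n) 0 \<noteq> epoch_degree r (U \<omega>) n 0} =
    prob {\<omega>\<in>space M. epoch_degree r (U \<omega>) n 0 < d} * (1 - 1 / real CARD('a) ^ r)"
proof -
  let ?A = "{\<omega>\<in>space M. epoch_degree r (U \<omega>) n 0 < d}"
  let ?H = "{\<omega>\<in>?A. epoch_degree r (U \<omega>) (Suc n) 0 = epoch_degree r (U \<omega>) n 0}"
  have all: "{\<omega>\<in>?A. epoch_degree r (U \<omega>) n 0 \<le> epoch_degree r (U \<omega>) (Suc n) 0} = ?A"
  proof -
    have "epoch_degree r u n 0 \<le> epoch_degree r u (Suc n) 0" for u :: "nat \<Rightarrow> nat \<Rightarrow> 'a"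
      using first_epoch_Suc[of r u n] enumerate_mono_le_iff[OF infinite_epochs, of r u n 0] by auto
    then show ?thesis by blast
  qed
  have H: "prob ?H = prob {\<omega>\<in>?A. epoch_degree r (U \<omega>) n 0 \<le> epoch_degree r (U \<omega>) (Suc n) 0} *
      (real CARD('a) ^ 0 / real CARD('a) ^ r)"
  proof (rule prob_first_survival_at)
    fix c
    have "known r (n + c) (\<lambda>u :: nat \<Rightarrow> nat \<Rightarrow> 'a. epoch_degree r u n 0 = c \<and> c < d)"
      using known_epoch_degree_eq[of n c "n + c" r 0, where 'a='a] by (simp add: known_def)
    then show "\<exists>\<Phi>. known r (n + c) \<Phi> \<and>
        (\<forall>\<omega>\<in>space M. \<Phi> (U \<omega>) \<longleftrightarrow> \<omega> \<in> ?A \<and> epoch_degree r (U \<omega>) n 0 = c)"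
      by (intro exI[of _ "\<lambda>u. epoch_degree r u n 0 = c \<and> c < d"]) auto
  qed measurable
  have H: "prob ?H = prob ?A * (1 / real CARD('a) ^ r)"
    using H unfolding all by simp
  have eq: "{\<omega>\<in>space M. epoch_degree r (U \<omega>) n 0 < d \<and>
      epoch_degree r (U \<omega>) (Suc n) 0 \<noteq> epoch_degree r (U \<omega>) n 0} = ?A - ?H" by blast
  have "prob (?A - ?H) = prob ?A - prob ?H"
  proof (rule finite_measure_Diff)
    show A: "?A \<in> sets M" by measurable
    show "?H \<in> sets M" by (rule sets_Collect_mem[OF A sets_survival(2)])
  qed blast
  with H show ?thesis unfolding eq by (simp add: algebra_simps)
qed

lemma prob_jump:
  "prob {\<omega>\<in>space M. epoch_degree r (U \<omega>) (Suc n) 0 \<noteq> epoch_degree r (U \<omega>) n 0} = 1 - 1 / real CARD('a) ^ r"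
proof -
  have all: "epoch_degree r u n 0 < Suc (r * n)" for u :: "nat \<Rightarrow> nat \<Rightarrow> 'a"
    using epoch_degree_le[of r u n 0] by simp
  show ?thesis
    using prob_jump_and_first_epoch_less[of n "Suc (r * n)"] by (simp add: all prob_space)
qed

end

section \<open>Coefficients of Haar-distributed series\<close>

lemma open_fls_nth_eq: "open {f :: 'a::group_add fls. fls_nth f k = c}"
  unfolding open_fls_def
proof (intro ballI exI conjI)
  fix a :: "'a fls" assume a: "a \<in> {f. fls_nth f k = c}"
  show "(0::real) < inverse (2 ^ nat k)" by simp
  show "{y. dist y a < inverse (2 ^ nat k)} \<subseteq> {f. fls_nth f k = c}"
  proof
    fix y assume "y \<in> {y. dist y a < inverse (2 ^ nat k)}"
    then have dist: "dist y a < inverse (2 ^ nat k)" by simp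
    have "fls_nth (y - a) k = 0"
    proof (rule ccontr)
      assume nz: "fls_nth (y - a) k \<noteq> 0"
      then have neq: "y \<noteq> a" by auto
      have le: "fls_subdegree (y - a) \<le> k" by (rule fls_subdegree_leI[OF nz])
      show False
      proof (cases "fls_subdegree (y - a) \<ge> 0")
        case True
        with le have "(2::real) ^ nat (fls_subdegree (y - a)) \<le> 2 ^ nat k"
          by (intro power_increasing) auto
        then have "inverse (2 ^ nat k) \<le> inverse ((2::real) ^ nat (fls_subdegree (y - a)))"
          by (intro le_imp_inverse_le) auto
        moreover have "dist y a = inverse (2 ^ nat (fls_subdegree (y - a)))"
          using True neq by (simp add: dist_fls_def)
        ultimately show False using dist by linarith
      next
        case False
        have "inverse ((2::real) ^ nat k) \<le> 1"
          by (simp add: inverse_le_1_iff)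
        also have "(1::real) \<le> 2 ^ nat (- fls_subdegree (y - a))" by simp
        finally show False using False dist neq by (simp add: dist_fls_def)
      qed
    qed
    with a show "y \<in> {f. fls_nth f k = c}" by simp
  qed
qed

definition cylinder :: "nat \<Rightarrow> (nat \<Rightarrow> 'a::{field,finite}) \<Rightarrow> 'a fls set" where
  "cylinder N v = {f\<in>pp. \<forall>j\<in>{1..N}. fls_nth f (int j) = v j}"

lemma space_borel_pp: "space (borel_pp :: 'a::{field,finite} fls measure) = pp"
  by (simp add: borel_pp_def space_restrict_space)

lemma sets_cylinder: "cylinder N v \<in> sets (borel_pp :: 'a::{field,finite} fls measure)"
proof -
  have "{f :: 'a fls. fls_nth f (int j) = v j} \<in> sets borel" for j
    by (intro borel_open open_fls_nth_eq)
  then have "{f \<in> space borel. \<forall>j\<in>{1..N}. fls_nth f (int j) = v j} \<in> sets (borel :: 'a fls measure)"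
    by (intro sets.sets_Collect_finite_All) auto
  moreover have "cylinder N v = {f \<in> space borel. \<forall>j\<in>{1..N}. fls_nth f (int j) = v j} \<inter> pp"
    by (auto simp: cylinder_def)
  moreover have "(pp :: 'a fls set) \<in> sets borel"
  proof -
    have "(pp :: 'a fls set) = (\<Inter>k. {f. fls_nth f (- int k) = 0})"
    proof (intro equalityI subsetI)
      fix f :: "'a fls" assume f: "f \<in> (\<Inter>k. {f. fls_nth f (- int k) = 0})"
      have "fls_nth f k = 0" if "k \<le> 0" for k
        using f that by (auto dest!: spec[of _ "nat (- k)"])
      then show "f \<in> pp" by (simp add: pp_def)
    qed (auto simp: pp_def)
    also have "\<dots> \<in> sets borel"
      by (intro sets.countable_INT) (auto intro!: borel_open open_fls_nth_eq)
    finally show ?thesis .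
  qed
  ultimately show ?thesis
    by (auto simp: borel_pp_def sets_restrict_space)
qed

lemma ex_cylinder_point:
  fixes v :: "nat \<Rightarrow> 'a::{field,finite}"
  shows "\<exists>a\<in>pp. \<forall>j\<in>{1..N}. fls_nth a (int j) = v j"
proof
  let ?f = "fps_to_fls (Abs_fps (\<lambda>j. if j = 0 then 0 else v j))"
  show "?f \<in> pp" by (auto simp: pp_def)
  show "\<forall>j\<in>{1..N}. fls_nth ?f (int j) = v j" by auto
qed

lemma cylinder_translate:
  fixes a :: "'a::{field,finite} fls"
  assumes "a \<in> pp" "\<forall>j\<in>{1..N}. fls_nth a (int j) = v j"
  shows "cylinder N v = (+) a ` cylinder N (\<lambda>_. 0)"
proof (intro equalityI subsetI)
  fix f assume "f \<in> cylinder N v"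
  then have "f - a \<in> cylinder N (\<lambda>_. 0)"
    using assms by (auto simp: cylinder_def pp_def)
  then show "f \<in> (+) a ` cylinder N (\<lambda>_. 0)"
    by (rule rev_image_eqI) simp
qed (use assms in \<open>auto simp: cylinder_def pp_def\<close>)

text \<open>
  Any two cylinders of length \<open>N\<close> are translates of each other, so the \<open>q\<^sup>N\<close> cylinders of a partition of
  \<^const>\<open>pp\<close> have the same measure.
\<close>

lemma haar_prob_cylinder:
  fixes \<mu> :: "'a::{field,finite} fls measure"
  assumes "haar_prob \<mu>"
  shows "measure \<mu> (cylinder N v) = 1 / real CARD('a) ^ N"
proof -
  interpret prob_space \<mu> using assms by (simp add: haar_prob_def)
  have sets: "sets \<mu> = sets borel_pp" using assms by (simp add: haar_prob_def)
  then have space: "space \<mu> = pp" using sets_eq_imp_space_eq space_borel_pp by metis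
  have cyl: "cylinder N w \<in> sets \<mu>" for w using sets_cylinder sets by simp
  have same: "measure \<mu> (cylinder N w) = measure \<mu> (cylinder N (\<lambda>_. 0))" for w
  proof -
    obtain a :: "'a fls" where a: "a \<in> pp" "\<forall>j\<in>{1..N}. fls_nth a (int j) = w j"
      using ex_cylinder_point by blast
    have "emeasure \<mu> ((+) a ` cylinder N (\<lambda>_. 0)) = emeasure \<mu> (cylinder N (\<lambda>_. 0))"
      using assms a(1) cyl by (simp add: haar_prob_def)
    then show ?thesis
      unfolding cylinder_translate[OF a] by (simp add: measure_def)
  qed
  let ?W = "{w :: nat \<Rightarrow> 'a. \<forall>j. j \<notin> {1..N} \<longrightarrow> w j = 0}"
  have "pp = (\<Union>w\<in>?W. cylinder N w)"
  proof (intro equalityI subsetI)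
    fix f :: "'a fls" assume "f \<in> pp"
    then show "f \<in> (\<Union>w\<in>?W. cylinder N w)"
      by (intro UN_I[of "\<lambda>j. if j \<in> {1..N} then fls_nth f (int j) else 0"]) (auto simp: cylinder_def)
  qed (auto simp: cylinder_def)
  then have "1 = prob (\<Union>w\<in>?W. cylinder N w)"
    using prob_space space by simp
  also have "\<dots> = (\<Sum>w\<in>?W. prob (cylinder N w))"
  proof (rule finite_measure_finite_Union)
    show "disjoint_family_on (cylinder N) ?W"
    proof (unfold disjoint_family_on_def, intro ballI impI)
      fix w w' assume w: "w \<in> ?W" "w' \<in> ?W" "w \<noteq> w'"
      then obtain j where "w j \<noteq> w' j" by (meson ext)
      moreover from this w have "j \<in> {1..N}" by (metis (mono_tags, lifting) mem_Collect_eq)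
      ultimately show "cylinder N w \<inter> cylinder N w' = {}" by (auto simp: cylinder_def)
    qed
    show "finite ?W" by (rule finite_supported_functions) simp
  qed (use cyl in auto)
  also have "\<dots> = (\<Sum>w\<in>?W. prob (cylinder N (\<lambda>_. 0)))"
    by (rule sum.cong[OF refl same])
  also have "\<dots> = real CARD('a) ^ N * prob (cylinder N (\<lambda>_. 0))"
    by (simp only: sum_constant card_supported_functions finite_atLeastAtMost) simp
  finally show ?thesis
    using same[of v] by (simp add: field_simps)
qed

lemma uniform_coefficients_haar:
  fixes \<alpha> :: "nat \<Rightarrow> 'w \<Rightarrow> 'a::{field,finite} fls"
  assumes "prob_space M" and r: "r \<ge> 1"
    and indep: "prob_space.indep_vars M (\<lambda>_. borel_pp) \<alpha> {1..r}"
    and haar: "\<And>i. i \<in> {1..r} \<Longrightarrow> haar_prob (distr M borel_pp (\<alpha> i))"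
  shows "uniform_coefficients M (\<lambda>\<omega>. laurent_coeffs (\<lambda>i. \<alpha> i \<omega>)) r"
proof -
  interpret prob_space M by fact
  have rv: "\<alpha> i \<in> M \<rightarrow>\<^sub>M borel_pp" if "i \<in> {1..r}" for i
    using indep that by (simp add: indep_vars_def2)
  have eq: "{\<omega>\<in>space M. trunc r N (laurent_coeffs (\<lambda>i. \<alpha> i \<omega>)) = c} =
      (\<Inter>i\<in>{1..r}. \<alpha> i -` cylinder N (c i) \<inter> space M)" if c: "c \<in> range (trunc r N)" for N c
  proof -
    have c0: "c i j = 0" if "i \<notin> {1..r} \<or> j \<notin> {1..N}" for i j
      using c that by (auto simp: trunc_def)
    have pp: "\<alpha> i \<omega> \<in> pp" if "\<omega> \<in> space M" "i \<in> {1..r}" for i \<omega>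
      using measurable_space[OF rv[OF that(2)] that(1)] by (simp add: space_borel_pp)
    have "trunc r N u = c \<longleftrightarrow> (\<forall>i\<in>{1..r}. \<forall>j\<in>{1..N}. u i j = c i j)" for u
      using c0 unfolding trunc_def fun_eq_iff by metis
    then show ?thesis
      using r pp by (auto simp: cylinder_def)
  qed
  show ?thesis
  proof unfold_locales
    fix N c
    show "{\<omega>\<in>space M. trunc r N (laurent_coeffs (\<lambda>i. \<alpha> i \<omega>)) = c} \<in> sets M"
    proof (cases "c \<in> range (trunc r N)")
      case True
      show ?thesis
        unfolding eq[OF True] using r
        by (intro sets.finite_INT measurable_sets[OF rv sets_cylinder]) auto
    next
      case False
      then have "{\<omega>\<in>space M. trunc r N (laurent_coeffs (\<lambda>i. \<alpha> i \<omega>)) = c} = {}" by blast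
      then show ?thesis by (simp only: sets.empty_sets)
    qed
  next
    fix N and c :: "nat \<Rightarrow> nat \<Rightarrow> 'a" assume c: "c \<in> range (trunc r N)"
    have "prob {\<omega>\<in>space M. trunc r N (laurent_coeffs (\<lambda>i. \<alpha> i \<omega>)) = c} =
        (\<Prod>i\<in>{1..r}. prob (\<alpha> i -` cylinder N (c i) \<inter> space M))"
      unfolding eq[OF c] using r
      by (intro indep_varsD_finite[OF indep] sets_cylinder) auto
    also have "\<dots> = (\<Prod>i\<in>{1..r}. 1 / real CARD('a) ^ N)"
    proof (rule prod.cong[OF refl])
      fix i assume i: "i \<in> {1..r}"
      show "prob (\<alpha> i -` cylinder N (c i) \<inter> space M) = 1 / real CARD('a) ^ N"
        using haar_prob_cylinder[OF haar[OF i], of N "c i"]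
        by (simp add: measure_distr[OF rv[OF i] sets_cylinder])
    qed
    also have "\<dots> = 1 / real CARD('a) ^ (r * N)"
      by (simp add: power_one_over power_mult[symmetric] mult.commute)
    finally show "prob {\<omega>\<in>space M. trunc r N (laurent_coeffs (\<lambda>i. \<alpha> i \<omega>)) = c} = 1 / real CARD('a) ^ (r * N)" .
  qed
qed

section \<open>The coefficient filtration and the stopped sigma-algebra\<close>

lemma space_coeff_filtration: "space (coeff_filtration M r \<alpha> N) = space M"
  unfolding coeff_filtration_def by (rule space_measure_of) auto

text \<open>
  The predicates known from the first \<open>N\<close> vectors form a sigma-algebra that contains the generators;
  conversely such a predicate is a finite union of atoms, which are finite intersections of generators.
\<close>

lemma sets_coeff_filtration:
  fixes \<alpha> :: "nat \<Rightarrow> 'w \<Rightarrow> 'a::{field,finite} fls"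
  shows "sets (coeff_filtration M r \<alpha> N) =
    {{\<omega>\<in>space M. \<Phi> (laurent_coeffs (\<lambda>i. \<alpha> i \<omega>))} | \<Phi>. known r N \<Phi>}"
proof (intro equalityI subsetI)
  let ?G = "{{\<omega> \<in> space M. fls_nth (\<alpha> i \<omega>) (int j) = c} | i j c. i \<in> {1..r} \<and> j \<in> {1..N}}"
  let ?R = "{{\<omega>\<in>space M. \<Phi> (laurent_coeffs (\<lambda>i. \<alpha> i \<omega>))} | \<Phi>. known r N \<Phi>}"
  fix A assume "A \<in> sets (coeff_filtration M r \<alpha> N)"
  moreover have "?G \<subseteq> Pow (space M)" by auto
  ultimately have "A \<in> sigma_sets (space M) ?G"
    by (simp add: coeff_filtration_def)
  then show "A \<in> ?R"
  proof induction
    case (Basic a)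
    then obtain i j c where a: "a = {\<omega> \<in> space M. fls_nth (\<alpha> i \<omega>) (int j) = c}"
      "i \<in> {1..r}" "j \<in> {1..N}" by blast
    then have "known r N (\<lambda>u :: nat \<Rightarrow> nat \<Rightarrow> 'a. u i j = c)"
      by (simp add: known_def trunc_def)
    with a(1) show ?case by (intro CollectI exI[of _ "\<lambda>u. u i j = c"]) simp
  next
    case Empty
    have "known r N (\<lambda>u :: nat \<Rightarrow> nat \<Rightarrow> 'a. False)" by (rule known_const)
    then show ?case by (intro CollectI exI[of _ "\<lambda>u. False"]) simp
  next
    case (Compl a)
    then obtain \<Phi> where \<Phi>: "known r N \<Phi>" "a = {\<omega>\<in>space M. \<Phi> (laurent_coeffs (\<lambda>i. \<alpha> i \<omega>))}" by blast
    then have "known r N (\<lambda>u. \<not> \<Phi> u)" by (simp add: known_def)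
    moreover have "space M - a = {\<omega>\<in>space M. \<not> \<Phi> (laurent_coeffs (\<lambda>i. \<alpha> i \<omega>))}" using \<Phi>(2) by auto
    ultimately show ?case by (intro CollectI exI[of _ "\<lambda>u. \<not> \<Phi> u"]) simp
  next
    case (Union a)
    from Union.IH have "\<forall>k. \<exists>\<Phi>. a k = {\<omega>\<in>space M. \<Phi> (laurent_coeffs (\<lambda>i. \<alpha> i \<omega>))} \<and> known r N \<Phi>"
      unfolding mem_Collect_eq by (rule allI)
    from choice[OF this] obtain \<Phi> where \<Phi>: "\<And>k. known r N (\<Phi> k)"
      "\<And>k. a k = {\<omega>\<in>space M. \<Phi> k (laurent_coeffs (\<lambda>i. \<alpha> i \<omega>))}" by blast
    then have "known r N (\<lambda>u. \<exists>k. \<Phi> k u)" by (simp add: known_def)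
    moreover have "(\<Union>k. a k) = {\<omega>\<in>space M. \<exists>k. \<Phi> k (laurent_coeffs (\<lambda>i. \<alpha> i \<omega>))}" using \<Phi>(2) by auto
    ultimately show ?case by (intro CollectI exI[of _ "\<lambda>u. \<exists>k. \<Phi> k u"]) simp
  qed
next
  let ?F = "coeff_filtration M r \<alpha> N"
  let ?U = "\<lambda>\<omega>. laurent_coeffs (\<lambda>i. \<alpha> i \<omega>)"
  fix A assume "A \<in> {{\<omega>\<in>space M. \<Phi> (?U \<omega>)} | \<Phi>. known r N \<Phi>}"
  then obtain \<Phi> where \<Phi>: "known r N \<Phi>" "A = {\<omega>\<in>space M. \<Phi> (?U \<omega>)}" by blast
  have basic: "{\<omega> \<in> space ?F. ?U \<omega> i j = c} \<in> sets ?F" if "i \<in> {1..r}" "j \<in> {1..N}" for i j c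
  proof -
    have "{\<omega> \<in> space M. ?U \<omega> i j = c} \<in> sets ?F"
      unfolding coeff_filtration_def by (rule in_measure_of) (use that in auto)
    then show ?thesis by (simp add: space_coeff_filtration)
  qed
  have "{\<omega> \<in> space M. trunc r N (?U \<omega>) = c} \<in> sets ?F" if c: "c \<in> range (trunc r N)" for c
  proof -
    have c0: "c i j = 0" if "i \<notin> {1..r} \<or> j \<notin> {1..N}" for i j
      using c that by (auto simp: trunc_def)
    have "trunc r N u = c \<longleftrightarrow> (\<forall>i\<in>{1..r}. \<forall>j\<in>{1..N}. u i j = c i j)" for u
      using c0 unfolding trunc_def fun_eq_iff by metis
    then have "{\<omega> \<in> space M. trunc r N (?U \<omega>) = c} =
        {\<omega> \<in> space ?F. \<forall>i\<in>{1..r}. \<forall>j\<in>{1..N}. ?U \<omega> i j = c i j}"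
      by (simp add: space_coeff_filtration)
    also have "\<dots> \<in> sets ?F"
      by (intro sets.sets_Collect_finite_All basic) auto
    finally show ?thesis .
  qed
  then show "A \<in> sets ?F"
    unfolding \<Phi>(2) known_event_eq[OF \<Phi>(1), of "space M" ?U]
    by (intro sets.finite_UN finite_subset[OF _ finite_range_trunc[of r N]]) auto
qed

lemma Ttime_eq: "Ttime r x n = n + epoch_degree r (laurent_coeffs x) n 0"
  by (simp add: Ttime_def Lmin_eq)

locale haar_tuple = prob_space M for M :: "'w measure" +
  fixes \<alpha> :: "nat \<Rightarrow> 'w \<Rightarrow> 'a::{field,finite} fls" and r :: nat
  assumes r_pos: "r \<ge> 1"
    and indep: "indep_vars (\<lambda>_. borel_pp) \<alpha> {1..r}"
    and haar: "i \<in> {1..r} \<Longrightarrow> haar_prob (distr M borel_pp (\<alpha> i))"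
begin

abbreviation "U \<omega> \<equiv> laurent_coeffs (\<lambda>i. \<alpha> i \<omega>)"
abbreviation "\<F> n \<equiv> stopped_sigma M r \<alpha> (\<lambda>\<omega>. Ttime r (\<lambda>i. \<alpha> i \<omega>) n + 1)"

sublocale uniform_coefficients M "\<lambda>\<omega>. laurent_coeffs (\<lambda>i. \<alpha> i \<omega>)" r
  by (rule uniform_coefficients_haar[OF prob_space_axioms r_pos indep haar])

sublocale filtration "space M" "coeff_filtration M r \<alpha>"
proof
  show "space (coeff_filtration M r \<alpha> N) = space M" for N
    by (rule space_coeff_filtration)
  show "sets (coeff_filtration M r \<alpha> N) \<le> sets (coeff_filtration M r \<alpha> N')" if "N \<le> N'" for N N'
    unfolding sets_coeff_filtration using known_mono[OF _ that]
    by (intro Collect_mono impI; elim exE conjE; intro exI conjI) auto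
qed

lemma filtration_subset: "sets (coeff_filtration M r \<alpha> N) \<subseteq> sets M"
proof
  fix A assume "A \<in> sets (coeff_filtration M r \<alpha> N)"
  then obtain \<Phi> where "known r N \<Phi>" "A = {\<omega>\<in>space M. \<Phi> (U \<omega>)}"
    unfolding sets_coeff_filtration by blast
  with known_event show "A \<in> sets M" by simp
qed

lemma stopping_time_Ttime: "stopping_time (coeff_filtration M r \<alpha>) (\<lambda>\<omega>. Ttime r (\<lambda>i. \<alpha> i \<omega>) n + 1)"
proof
  fix t
  have "known r t (\<lambda>u :: nat \<Rightarrow> nat \<Rightarrow> 'a. epoch_degree r u n 0 < t - n)"
    by (rule known_first_epoch_less) auto
  moreover have "{\<omega>\<in>space M. Ttime r (\<lambda>i. \<alpha> i \<omega>) n + 1 \<le> t} = {\<omega>\<in>space M. epoch_degree r (U \<omega>) n 0 < t - n}"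
    by (auto simp: Ttime_eq)
  ultimately show "Measurable.pred (coeff_filtration M r \<alpha> t) (\<lambda>\<omega>. Ttime r (\<lambda>i. \<alpha> i \<omega>) n + 1 \<le> t)"
    unfolding pred_def space_coeff_filtration sets_coeff_filtration
    by (intro CollectI exI[of _ "\<lambda>u. epoch_degree r u n 0 < t - n"] conjI)
qed

text \<open>
  The event \<open>T\<^sub>n + 1 \<le> n + d\<close> is \<open>\<sigma>\<^sub>0 < d\<close>, which turns membership in the stopped sigma-algebra into the
  form used in \<open>prob_no_survival_before\<close>. As \<open>T\<^sub>n + 1 \<le> n + r n + 1\<close>, one deterministic time suffices for
  measurability.
\<close>

lemma stopped_sets:
  assumes "A \<in> sets (\<F> n)"
  shows "A \<in> sets M"
    and "\<exists>\<Phi>. known r (n + d) \<Phi> \<and>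
      (\<forall>\<omega>\<in>space M. \<Phi> (U \<omega>) \<longleftrightarrow> \<omega> \<in> A \<and> epoch_degree r (U \<omega>) n 0 < d)"
proof -
  have F: "{\<omega>\<in>A. Ttime r (\<lambda>i. \<alpha> i \<omega>) n + 1 \<le> t} \<in> sets (coeff_filtration M r \<alpha> t)" for t
    using sets_pre_sigmaD[OF stopping_time_Ttime] assms unfolding stopped_sigma_def by blast
  have "{\<omega>\<in>A. Ttime r (\<lambda>i. \<alpha> i \<omega>) n + 1 \<le> n + r * n + 1} = A"
    using epoch_degree_le[of r _ n 0, where 'a='a] by (simp add: Ttime_eq)
  then show "A \<in> sets M" using F[of "n + r * n + 1"] filtration_subset by auto
  obtain \<Phi> where "known r (n + d) \<Phi>"
    "{\<omega>\<in>A. Ttime r (\<lambda>i. \<alpha> i \<omega>) n + 1 \<le> n + d} = {\<omega>\<in>space M. \<Phi> (U \<omega>)}"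
    using F[of "n + d"] unfolding sets_coeff_filtration by blast
  then show "\<exists>\<Phi>. known r (n + d) \<Phi> \<and>
      (\<forall>\<omega>\<in>space M. \<Phi> (U \<omega>) \<longleftrightarrow> \<omega> \<in> A \<and> epoch_degree r (U \<omega>) n 0 < d)"
    by (intro exI[of _ \<Phi>]) (auto simp: Ttime_eq set_eq_iff Suc_le_eq)
qed

lemma space_stopped: "space (\<F> n) = space M"
  unfolding stopped_sigma_def by (rule space_pre_sigma)

text \<open>
  Given \<open>\<sigma>\<^sub>0 = d\<close>, survival of \<open>\<sigma>\<^sub>0\<close> is decided by \<open>u\<^sub>1, \<dots>, u\<^sub>n\<^sub>+\<^sub>d\<^sub>+\<^sub>1\<close>, that is, at time \<open>T\<^sub>n + 1\<close>.
\<close>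

lemma jump_event_stopped: "{\<omega>\<in>space M. jump r (\<lambda>i. \<alpha> i \<omega>) n = 0} \<in> sets (\<F> n)"
  unfolding stopped_sigma_def
proof (rule sets_pre_sigmaI[OF stopping_time_Ttime])
  fix t
  \<comment> \<open>No jump means that both first epochs have the same degree \<open>d\<close>; at time \<open>t\<close> the degrees with
    \<open>n + 1 + d \<le> t\<close> have been examined.\<close>
  let ?\<Phi> = "\<lambda>u :: nat \<Rightarrow> nat \<Rightarrow> 'a. \<exists>d<t - n. epoch_degree r u n 0 = d \<and> epoch_degree r u (Suc n) 0 = d"
  have "epoch_degree r (trunc r t u) n 0 = d \<longleftrightarrow> epoch_degree r u n 0 = d"
    and "epoch_degree r (trunc r t u) (Suc n) 0 = d \<longleftrightarrow> epoch_degree r u (Suc n) 0 = d"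
    if "d < t - n" for d and u :: "nat \<Rightarrow> nat \<Rightarrow> 'a"
    using that by (intro knownD[OF known_epoch_degree_eq], simp)+
  then have "known r t ?\<Phi>"
    unfolding known_def by (intro allI ex_cong1 conj_cong refl)
  moreover have "{\<omega>\<in>{\<omega>\<in>space M. jump r (\<lambda>i. \<alpha> i \<omega>) n = 0}. Ttime r (\<lambda>i. \<alpha> i \<omega>) n + 1 \<le> t} =
      {\<omega>\<in>space M. ?\<Phi> (U \<omega>)}"
    by (auto simp: Ttime_eq jump_eq_0_iff)
  ultimately show "{\<omega>\<in>{\<omega>\<in>space M. jump r (\<lambda>i. \<alpha> i \<omega>) n = 0}. Ttime r (\<lambda>i. \<alpha> i \<omega>) n + 1 \<le> t}
      \<in> sets (coeff_filtration M r \<alpha> t)"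
    unfolding sets_coeff_filtration by (intro CollectI exI[of _ ?\<Phi>] conjI)
qed

lemma jump_1_eq: "{\<omega>\<in>space M. jump r (\<lambda>i. \<alpha> i \<omega>) n = 1} = space M - {\<omega>\<in>space M. jump r (\<lambda>i. \<alpha> i \<omega>) n = 0}"
  by (auto simp: jump_def)

lemma subalgebra_stopped: "subalgebra M (\<F> n)"
  unfolding subalgebra_def using space_stopped stopped_sets(1) by blast

section \<open>Law of the jump index and tail of the increment\<close>

lemma measurable_jump_index: "(\<lambda>\<omega>. jump_index r (\<lambda>i. \<alpha> i \<omega>) n) \<in> M \<rightarrow>\<^sub>M count_space UNIV"
proof (rule measurable_count_space_eq2_countable[THEN iffD2], intro conjI ballI)
  fix j
  have "{\<omega>\<in>space M. jump_index r (\<lambda>i. \<alpha> i \<omega>) n = j} \<in> sets M"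
    unfolding jump_index_eq_iff by (rule sets_survival(2))
  then show "(\<lambda>\<omega>. jump_index r (\<lambda>i. \<alpha> i \<omega>) n) -` {j} \<inter> space M \<in> sets M"
    by (simp add: vimage_def Int_def conj_commute)
qed auto

text \<open>
  A jump means \<open>\<sigma>\<^sub>1 \<le> min E\<^sub>n\<^sub>+\<^sub>1\<close>, the starting point of the product formula.
\<close>

lemma prob_jump_index_on_stopped:
  assumes A: "A \<in> sets (\<F> n)" and j: "j \<ge> 1"
  shows "prob {\<omega>\<in>A. jump_index r (\<lambda>i. \<alpha> i \<omega>) n = j} =
    prob {\<omega>\<in>A. jump r (\<lambda>i. \<alpha> i \<omega>) n = 1} * (real CARD('a) ^ j / real CARD('a) ^ r *
      (\<Prod>a\<in>{1..<j}. 1 - real CARD('a) ^ a / real CARD('a) ^ r))"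
proof -
  have "epoch_degree r u n 1 \<le> epoch_degree r u (Suc n) 0 \<longleftrightarrow>
      epoch_degree r u (Suc n) 0 \<noteq> epoch_degree r u n 0" for u :: "nat \<Rightarrow> nat \<Rightarrow> 'a"
  proof -
    obtain i where "epoch_degree r u (Suc n) 0 = epoch_degree r u n i"
      using first_epoch_Suc by blast
    then show ?thesis
      by (simp add: enumerate_mono_le_iff[OF infinite_epochs] epoch_degree_inject) linarith
  qed
  moreover have "jump r x n = 1 \<longleftrightarrow> jump r x n \<noteq> 0" for x :: "nat \<Rightarrow> 'a fls"
    by (simp add: jump_def)
  ultimately have J: "{\<omega>\<in>A. jump r (\<lambda>i. \<alpha> i \<omega>) n = 1} =
      {\<omega>\<in>A. epoch_degree r (U \<omega>) n 1 \<le> epoch_degree r (U \<omega>) (Suc n) 0}"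
    by (simp add: jump_eq_0_iff)
  show ?thesis
    unfolding J jump_index_eq_iff
    using prob_no_survival_before[OF stopped_sets[OF A] j] by simp
qed

lemma cond_exp_jump_index:
  assumes j: "j \<ge> 1"
  shows "AE \<omega> in M. real_cond_exp M (\<F> n) (indicator {\<omega> \<in> space M. jump_index r (\<lambda>i. \<alpha> i \<omega>) n = j}) \<omega> =
    indicator {\<omega> \<in> space M. jump r (\<lambda>i. \<alpha> i \<omega>) n = 1} \<omega> *
      (real CARD('a) ^ j / real CARD('a) ^ r *
        (\<Prod>a\<in>{1..<j}. 1 - real CARD('a) ^ a / real CARD('a) ^ r))"
    (is "AE \<omega> in M. _ \<omega> = indicator ?J \<omega> * ?c")
proof -
  let ?I = "{\<omega> \<in> space M. jump_index r (\<lambda>i. \<alpha> i \<omega>) n = j}"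
  interpret finite_measure_subalgebra M "\<F> n"
    by (rule finite_measure_subalgebra.intro[OF finite_measure_axioms
          finite_measure_subalgebra_axioms.intro[OF subalgebra_stopped]])
  have JF: "?J \<in> sets (\<F> n)"
    unfolding jump_1_eq using sets.compl_sets[OF jump_event_stopped[of n]] by (simp only: space_stopped)
  have I: "?I \<in> sets M"
    unfolding jump_index_eq_iff by (rule sets_survival(2))
  have J: "?J \<in> sets M" using stopped_sets(1)[OF JF] .
  show ?thesis
  proof (rule real_cond_exp_charact)
    fix A assume A: "A \<in> sets (\<F> n)"
    note AM = stopped_sets(1)[OF A]
    have "(\<integral>x\<in>A. indicator ?I x \<partial>M) = prob (A \<inter> ?I)"
      using AM I by (simp add: set_lebesgue_integral_def indicator_inter_arith[symmetric])
    also have "A \<inter> ?I = {\<omega>\<in>A. jump_index r (\<lambda>i. \<alpha> i \<omega>) n = j}"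
      using sets.sets_into_space[OF AM] by auto
    also have "prob \<dots> = prob {\<omega>\<in>A. jump r (\<lambda>i. \<alpha> i \<omega>) n = 1} * ?c"
      by (rule prob_jump_index_on_stopped[OF A j])
    also have "{\<omega>\<in>A. jump r (\<lambda>i. \<alpha> i \<omega>) n = 1} = A \<inter> ?J"
      using sets.sets_into_space[OF AM] by auto
    also have "prob (A \<inter> ?J) * ?c = (\<integral>x\<in>A. indicator ?J x * ?c \<partial>M)"
      using AM J by (simp add: set_lebesgue_integral_def indicator_inter_arith[symmetric] mult.assoc[symmetric])
    finally show "(\<integral>x\<in>A. indicator ?I x \<partial>M) = (\<integral>x\<in>A. indicator ?J x * ?c \<partial>M)" .
  next
    show "integrable M (indicator ?I :: _ \<Rightarrow> real)"
      using I by (simp add: integrable_indicator_iff emeasure_eq_measure)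
    show "integrable M (\<lambda>x. indicator ?J x * ?c)"
      using J by (intro integrable_mult_left) (simp add: integrable_indicator_iff emeasure_eq_measure)
    show "(\<lambda>x. indicator ?J x * ?c) \<in> borel_measurable (\<F> n)"
      using JF by (intro borel_measurable_times borel_measurable_indicator) auto
  qed
qed

lemma cond_exp_no_jump:
  "AE \<omega> in M. real_cond_exp M (\<F> n) (indicator {\<omega> \<in> space M. jump_index r (\<lambda>i. \<alpha> i \<omega>) n = 0}) \<omega> =
    indicator {\<omega> \<in> space M. jump r (\<lambda>i. \<alpha> i \<omega>) n = 0} \<omega>"
proof -
  interpret finite_measure_subalgebra M "\<F> n"
    by (rule finite_measure_subalgebra.intro[OF finite_measure_axioms
          finite_measure_subalgebra_axioms.intro[OF subalgebra_stopped]])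
  have eq: "{\<omega> \<in> space M. jump_index r (\<lambda>i. \<alpha> i \<omega>) n = 0} = {\<omega> \<in> space M. jump r (\<lambda>i. \<alpha> i \<omega>) n = 0}"
    by (simp add: jump_index_eq_iff jump_eq_0_iff)
  show ?thesis
    unfolding eq
  proof (rule real_cond_exp_F_meas)
    show "integrable M (indicator {\<omega> \<in> space M. jump r (\<lambda>i. \<alpha> i \<omega>) n = 0} :: _ \<Rightarrow> real)"
      using stopped_sets(1)[OF jump_event_stopped[of n]]
      by (simp add: integrable_indicator_iff emeasure_eq_measure)
  qed (rule borel_measurable_indicator[OF jump_event_stopped])
qed

lemma cond_prob_Delta_ge:
  assumes "h \<ge> int r + 1"
  shows "cond_prob M (\<lambda>\<omega>. Delta r (\<lambda>i. \<alpha> i \<omega>) n \<ge> h) (\<lambda>\<omega>. jump r (\<lambda>i. \<alpha> i \<omega>) n = 1)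
    \<le> real CARD('a) powi (int r + 1 - h) / (real CARD('a) - 1)"
proof -
  let ?q = "real CARD('a)"
  \<comment> \<open>The increment can reach \<open>h\<close> only if the slack is at least \<open>h - r\<close>, that is, if the first epoch is
    below \<open>r n + r + 1 - h\<close>; the truncation at 0 covers the case in which this number is negative.\<close>
  define d where "d = nat (int (r * n) + int r + 1 - h)"
  have q: "?q \<ge> 2" using CARD_field_ge_2[where 'a='a] by simp
  have J: "jump r x n = 1 \<longleftrightarrow> epoch_degree r (laurent_coeffs x) (Suc n) 0 \<noteq> epoch_degree r (laurent_coeffs x) n 0" for x :: "nat \<Rightarrow> 'a fls"
    unfolding jump_eq_0_iff[symmetric] by (simp add: jump_def)
  have PJ: "prob {\<omega>\<in>space M. jump r (\<lambda>i. \<alpha> i \<omega>) n = 1} = 1 - 1 / ?q ^ r"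
    unfolding J by (rule prob_jump)
  have pos: "1 - 1 / ?q ^ r > 0"
    using q r_pos power_le_one_iff[of ?q r] one_less_power[of ?q r] by simp
  have less: "epoch_degree r (laurent_coeffs x) n 0 < d" if "h \<le> Delta r x n" for x :: "nat \<Rightarrow> 'a fls"
    using that Delta_le_slack[of r x n] by (simp add: d_def slack_def Lmin_eq)
  have "prob {\<omega>\<in>space M. h \<le> Delta r (\<lambda>i. \<alpha> i \<omega>) n \<and> jump r (\<lambda>i. \<alpha> i \<omega>) n = 1} \<le>
      prob {\<omega>\<in>space M. epoch_degree r (U \<omega>) n 0 < d \<and>
        epoch_degree r (U \<omega>) (Suc n) 0 \<noteq> epoch_degree r (U \<omega>) n 0}"
  proof (rule finite_measure_mono)
    show "{\<omega>\<in>space M. epoch_degree r (U \<omega>) n 0 < d \<and>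
        epoch_degree r (U \<omega>) (Suc n) 0 \<noteq> epoch_degree r (U \<omega>) n 0} \<in> sets M"
    proof -
      have "{\<omega>\<in>space M. epoch_degree r (U \<omega>) n 0 < d \<and>
        epoch_degree r (U \<omega>) (Suc n) 0 \<noteq> epoch_degree r (U \<omega>) n 0} =
        {\<omega>\<in>space M. epoch_degree r (U \<omega>) n 0 < d} -
        {\<omega>\<in>space M. epoch_degree r (U \<omega>) (Suc n) 0 = epoch_degree r (U \<omega>) n 0}" by auto
      also have "\<dots> \<in> sets M" by (intro sets.Diff sets_survival(2)) measurable
      finally show ?thesis .
    qed
  qed (use less J in auto)
  also have "\<dots> = prob {\<omega>\<in>space M. epoch_degree r (U \<omega>) n 0 < d} * (1 - 1 / ?q ^ r)"
    by (rule prob_jump_and_first_epoch_less)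
  finally have "cond_prob M (\<lambda>\<omega>. Delta r (\<lambda>i. \<alpha> i \<omega>) n \<ge> h) (\<lambda>\<omega>. jump r (\<lambda>i. \<alpha> i \<omega>) n = 1)
      \<le> prob {\<omega>\<in>space M. epoch_degree r (U \<omega>) n 0 < d}"
    unfolding cond_prob_def PJ pos_divide_le_eq[OF pos] .
  also have "\<dots> \<le> ?q powi (int r + 1 - h) / (?q - 1)"
  proof (cases "d = 0")
    case True
    then show ?thesis using q by simp
  next
    case False
    then have d: "int d = int (r * n) + (int r + 1 - h)" by (simp add: d_def)
    have "prob {\<omega>\<in>space M. epoch_degree r (U \<omega>) n 0 < d} \<le> (?q ^ d - 1) / ((?q - 1) * ?q ^ (r * n))"
      by (rule prob_first_epoch_less_le)
    also have "\<dots> \<le> ?q ^ d / ((?q - 1) * ?q ^ (r * n))"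
      using q by (intro divide_right_mono) auto
    also have "?q ^ d = ?q ^ (r * n) * ?q powi (int r + 1 - h)"
      using q d power_int_add[of ?q "int (r * n)" "int r + 1 - h"]
      by (metis power_int_of_nat not_numeral_le_zero)
    also have "?q ^ (r * n) * ?q powi (int r + 1 - h) / ((?q - 1) * ?q ^ (r * n)) = ?q powi (int r + 1 - h) / (?q - 1)"
      using q by simp
    finally show ?thesis .
  qed
  finally show ?thesis .
qed

end

theorem theorem4p5:
  fixes M :: "'w measure"
    and \<alpha> :: "nat \<Rightarrow> 'w \<Rightarrow> 'a::{field,finite} fls"
    and q r n :: nat
  assumes "q = CARD('a)"
    and "r \<ge> 1"
    and "prob_space M"
    and "prob_space.indep_vars M (\<lambda>_. borel_pp) \<alpha> {1..r}"
    and "\<And>i. i \<in> {1..r} \<Longrightarrow> haar_prob (distr M borel_pp (\<alpha> i))"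
  shows "(\<forall>\<omega>\<in>space M. jump r (\<lambda>i. \<alpha> i \<omega>) n = 1 \<longrightarrow>
            (\<exists>!i. i \<in> {1..r} \<and>
                  Delta r (\<lambda>i. \<alpha> i \<omega>) n = int (tau r (\<lambda>i. \<alpha> i \<omega>) n i)))
    \<and> (\<lambda>\<omega>. jump_index r (\<lambda>i. \<alpha> i \<omega>) n) \<in> M \<rightarrow>\<^sub>M count_space UNIV
    \<and> (\<forall>j\<in>{1..r}. AE \<omega> in M.
          real_cond_exp M (stopped_sigma M r \<alpha> (\<lambda>\<omega>. Ttime r (\<lambda>i. \<alpha> i \<omega>) n + 1))
            (indicator {\<omega> \<in> space M. jump_index r (\<lambda>i. \<alpha> i \<omega>) n = j}) \<omega>
          = indicator {\<omega> \<in> space M. jump r (\<lambda>i. \<alpha> i \<omega>) n = 1} \<omega>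
            * real q powi (int j - int r)
            * (\<Prod>a\<in>{1..<j}. 1 - real q powi (int a - int r)))
    \<and> (AE \<omega> in M.
          real_cond_exp M (stopped_sigma M r \<alpha> (\<lambda>\<omega>. Ttime r (\<lambda>i. \<alpha> i \<omega>) n + 1))
            (indicator {\<omega> \<in> space M. jump_index r (\<lambda>i. \<alpha> i \<omega>) n = 0}) \<omega>
          = indicator {\<omega> \<in> space M. jump r (\<lambda>i. \<alpha> i \<omega>) n = 0} \<omega>)
    \<and> (\<forall>\<omega>\<in>space M. jump r (\<lambda>i. \<alpha> i \<omega>) n = 1 \<longrightarrow>
          Delta r (\<lambda>i. \<alpha> i \<omega>) n \<le> slack r (\<lambda>i. \<alpha> i \<omega>) n + int r)
    \<and> (\<forall>h::int. h \<ge> int r + 1 \<longrightarrow>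
          cond_prob M (\<lambda>\<omega>. Delta r (\<lambda>i. \<alpha> i \<omega>) n \<ge> h) (\<lambda>\<omega>. jump r (\<lambda>i. \<alpha> i \<omega>) n = 1)
          \<le> real q powi (int r + 1 - h) / (real q - 1))"
proof -
  interpret haar_tuple M \<alpha> r
    using assms by (intro haar_tuple.intro haar_tuple_axioms.intro) auto
  have pow: "real CARD('a) powi (int a - int r) = real CARD('a) ^ a / real CARD('a) ^ r" for a
    by (simp add: power_int_diff)
  have j: "\<forall>j\<in>{1..r}. AE \<omega> in M.
      real_cond_exp M (\<F> n) (indicator {\<omega> \<in> space M. jump_index r (\<lambda>i. \<alpha> i \<omega>) n = j}) \<omega>
      = indicator {\<omega> \<in> space M. jump r (\<lambda>i. \<alpha> i \<omega>) n = 1} \<omega>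
        * real q powi (int j - int r) * (\<Prod>a\<in>{1..<j}. 1 - real q powi (int a - int r))"
  proof
    fix j assume "j \<in> {1..r}"
    then have "j \<ge> 1" by simp
    from cond_exp_jump_index[OF this, of n]
    show "AE \<omega> in M.
      real_cond_exp M (\<F> n) (indicator {\<omega> \<in> space M. jump_index r (\<lambda>i. \<alpha> i \<omega>) n = j}) \<omega>
      = indicator {\<omega> \<in> space M. jump r (\<lambda>i. \<alpha> i \<omega>) n = 1} \<omega>
        * real q powi (int j - int r) * (\<Prod>a\<in>{1..<j}. 1 - real q powi (int a - int r))"
      unfolding assms(1) pow by (simp only: mult.assoc)
  qed
  show ?thesis
    using ex1_jump_index measurable_jump_index j cond_exp_no_jump Delta_le_slack
      cond_prob_Delta_ge[where n = n] unfolding assms(1) by blast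
qed

end
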